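(* Let $d\ge2$ and $\tau_0,\ldots,\tau_d>0$. Let $e_0,\ldots,e_d$ be the standard orthonormal basis of $\mathbb R^{d+1}$ and consider the $d$-dimensional simplex $$S:=\Bigl[w,\frac{e_1}{\tau_1},\ldots,\frac{e_d}{\tau_d}\Bigr],\qquad w=\frac{\tau_0e_0+\tau_1e_1+\cdots+\tau_de_d}{\tau_0^2+\tau_1^2+\cdots+\tau_d^2},$$ regarded as a simplex in its $d$-dimensional affine hull $\operatorname{aff}S$, identified with $\mathbb R^d$; tangent and normal cones are taken in this $d$-dimensional ambient space. (a) $T(S,S)=\mathbb R^d$ and $N(S,S)=\{0\}$. (b) For $k\in\{0,\ldots,d-1\}$ and $F=[\frac{e_1}{\tau_1},\ldots,\frac{e_{k+1}}{\tau_{k+1}}]$, the tangent cone $T(F,S)=L\oplus C$ is the direct orthogonal sum of the lineality space $L$ of $F$ and a cone $C$ isometric to $$C_{d-k}(\tau_1^2+\cdots+\tau_{k+1}^2;\ -\tau_0^2-\tau_1^2-\cdots-\tau_d^2,\tau_{k+2}^2,\ldots,\tau_d^2;\ 1,\ldots,1).$$ The normal cone $N(F,S)$ is isometric to $$C_{d-k}(\tau_0^2;\ -\tau_0^2-\tau_1^2-\cdots-\tau_d^2,\tau_{k+2}^2,\ldots,\tau_d^2;\ -1,1,\ldots,1).$$ (c) For $k\in\{0,\ldots,d-1\}$ and $F=[w,\frac{e_1}{\tau_1},\ldots,\frac{e_k}{\tau_k}]$, the tangent cone $T(F,S)=L\oplus C$ is the direct orthogonal sum of the lineality space $L$ of $F$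 and a cone $C$ isometric to $$C_{d-k}(-\tau_0^2-\tau_{k+1}^2-\cdots-\tau_d^2;\ \tau_{k+1}^2,\ldots,\tau_d^2;\ 1,\ldots,1).$$ The normal cone $N(F,S)$ is isometric to $$C_{d-k}(\tau_0^2;\ \tau_{k+1}^2,\ldots,\tau_d^2;\ 1,\ldots,1).$$ (d) For $k\in\{0,\ldots,d-1\}$, the internal and external angles of $S$ at $F=[\frac{e_1}{\tau_1},\ldots,\frac{e_{k+1}}{\tau_{k+1}}]$ are $$\beta(F,S)=\mathbf g_{d-k}(\tau_0^2;\ -\tau_0^2-\cdots-\tau_d^2,\tau_{k+2}^2,\ldots,\tau_d^2;\ -1,1,\ldots,1),$$ $$\gamma(F,S)=\mathbf g_{d-k}(\tau_1^2+\cdots+\tau_{k+1}^2;\ -\tau_0^2-\cdots-\tau_d^2,\tau_{k+2}^2,\ldots,\tau_d^2;\ 1,\ldots,1).$$ For $k\in\{0,1,\ldots,d\}$, the internal and external angles of $S$ at $F=[w,\frac{e_1}{\tau_1},\ldots,\frac{e_k}{\tau_k}]$ are $$\beta(F,S)=\mathbf g_{d-k}(\tau_0^2;\ \tau_{k+1}^2,\ldots,\tau_d^2;\ 1,\ldots,1),$$ $$\gamma(F,S)=\mathbf g_{d-k}(-\tau_0^2-\tau_{k+1}^2-\cdots-\tau_d^2;\ \tau_{k+1}^2,\ldots,\tau_d^2;\ 1,\ldots,1).$$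
   Context: $[\ldots]$ denotes the convex hull. For a face $F$ of a polytope $P$ in a Euclidean space $V$ and $x_0$ in the relative interior of $F$, the tangent cone is $T(F,P)=\{v\in V:x_0+\varepsilon v\in P\text{ for some }\varepsilon>0\}$ and the normal cone is its polar $N(F,P)=\{v\in V:\langle v,z-x_0\rangle\le0\text{ for all }z\in P\}$. The lineality space of $F$ is the linear subspace parallel to its affine hull. The solid angle of a polyhedral cone $C$ is $\alpha(C)=\mathbb P[\xi\in C]$ with $\xi$ standard Gaussian on the linear hull of $C$ (so $\alpha(\{0\})=1$); $\beta(F,P):=\alpha(T(F,P))$, $\gamma(F,P):=\alpha(N(F,P))$. Condition on parameters: nonzero real $\lambda_0,\ldots,\lambda_m$ satisfy (A) if all are positive, and (B) if exactly one is negative, all others are positive and $\lambda_0+\cdots+\lambda_m<0$. Orthocentric cone: for $m\in\mathbb N$, $\lambda_0,\ldots,\lambda_m$ satisfying (A) or (B) and $\varepsilon_i\in\{\pm1\}$, $C_m(\lambda_0;\lambda_1,\ldots,\lambda_m;\varepsilon_1,\ldots,\varepsilon_m):=\operatorname{pos}(\varepsilon_1u_1,\ldots,\varepsilon_mu_m)$ (positive hull), where $u_1,\ldots,u_m$ are linearly independent vectors in some $\mathbb R^N$, $N\ge m$, with $\langle u_i,u_j\rangle=\frac1{\lambda_0}+\frac{\delta_{ij}}{\lambda_i}$ for all $i,j$; it is defined up to isometry. Function $\mathbf g_m$: under the same conditions, $\mathbf g_m(\lambda_0;\lambda_1,\ldots,\lambda_m;\varepsilon_1,\ldots,\varepsilon_m):=\mathbb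 P[\varepsilon_1\eta_1<0,\ldots,\varepsilon_m\eta_m<0]$, where $(\eta_1,\ldots,\eta_m)$ is centered Gaussian with covariance matrix $\bigl(\frac1{\lambda_0}+\frac{\delta_{ij}}{\lambda_i}\bigr)_{i,j=1}^m$. Also $\mathbf g_0(\lambda_0):=1$ for all $\lambda_0\in\mathbb R$. *)

theory Defs
  imports "HOL-Probability.Probability"
begin

section \<open>Tangent and normal cones\<close>

text \<open>The linear subspace parallel to the affine hull of \<open>A\<close>. For a face this is its lineality space.\<close>

definition direction_space :: "'a::euclidean_space set \<Rightarrow> 'a set" where
  "direction_space A = {x - y | x y. x \<in> affine hull A \<and> y \<in> affine hull A}"

lemma direction_space_affine_parallel:
  assumes "A \<noteq> {}"
  shows "subspace (direction_space A)" "affine_parallel (direction_space A) (affine hull A)"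
proof -
  obtain a where a: "a \<in> affine hull A" using assms hull_inc by fastforce
  have sub: "subspace {x - y |x y. x \<in> affine hull A \<and> y \<in> affine hull A}"
  proof -
    have s: "subspace ((\<lambda>x. x - a) ` (affine hull A))"
      using affine_diffs_subspace_subtract[OF affine_affine_hull a] .
    have "{x - y |x y. x \<in> affine hull A \<and> y \<in> affine hull A} = (\<lambda>x. x - a) ` (affine hull A)"
    proof (intro equalityI subsetI)
      fix v assume "v \<in> {x - y |x y. x \<in> affine hull A \<and> y \<in> affine hull A}"
      then obtain x y where xy: "v = x - y" "x \<in> affine hull A" "y \<in> affine hull A" by blast
      have "(x - a) - (y - a) \<in> (\<lambda>x. x - a) ` (affine hull A)"
        by (rule subspace_diff[OF s]) (use xy in blast)+
      then show "v \<in> (\<lambda>x. x - a) ` (affine hull A)" by (simp add: xy(1))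
    qed (use a in blast)
    with s show ?thesis by simp
  qed
  then show "subspace (direction_space A)" by (simp add: direction_space_def)
  have "affine hull A = (\<lambda>x. a + x) ` direction_space A"
  proof (intro equalityI subsetI)
    fix x assume "x \<in> affine hull A"
    then have "x - a \<in> direction_space A" using a by (auto simp: direction_space_def)
    then show "x \<in> (\<lambda>x. a + x) ` direction_space A" by (metis add.commute diff_add_cancel image_eqI)
  next
    fix x assume "x \<in> (\<lambda>x. a + x) ` direction_space A"
    then obtain y z where yz: "x = a + (y - z)" "y \<in> affine hull A" "z \<in> affine hull A"
      by (auto simp: direction_space_def)
    have "a + 1 *\<^sub>R (y - z) \<in> affine hull A"
      using mem_affine_3_minus[OF affine_affine_hull a yz(2,3)] .
    then show "x \<in> affine hull A" using yz(1) by simp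
  qed
  then show "affine_parallel (direction_space A) (affine hull A)"
    unfolding affine_parallel_def by blast
qed

text \<open>\<open>V\<close> is the ambient linear space: if \<open>P\<close> is regarded as a polytope inside an affine subspace,
  \<open>V\<close> is the direction space of that subspace. The definitions do not depend on the
  chosen relatively interior point, see \<open>tangent_cone_eq\<close> and \<open>normal_cone_eq\<close>.\<close>

definition rel_interior_point :: "'a::euclidean_space set \<Rightarrow> 'a" where
  "rel_interior_point F = (SOME x. x \<in> rel_interior F)"

definition tangent_cone :: "'a::euclidean_space set \<Rightarrow> 'a set \<Rightarrow> 'a set \<Rightarrow> 'a set" where
  "tangent_cone V F P = {v \<in> V. \<exists>\<epsilon>>0. rel_interior_point F + \<epsilon> *\<^sub>R v \<in> P}"

definition normal_cone :: "'a::euclidean_space set \<Rightarrow> 'a set \<Rightarrow> 'a set \<Rightarrow> 'a set" where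
  "normal_cone V F P = {v \<in> V. \<forall>z\<in>P. v \<bullet> (z - rel_interior_point F) \<le> 0}"

lemma rel_interior_extend:
  fixes F :: "'a::euclidean_space set"
  assumes "convex F" "x \<in> rel_interior F" "y \<in> F"
  obtains \<delta> where "\<delta> > 0" "x + \<delta> *\<^sub>R (x - y) \<in> F"
proof -
  have "F \<noteq> {}" using assms by auto
  with assms obtain e where e: "e > 1" "(1 - e) *\<^sub>R y + e *\<^sub>R x \<in> F"
    using convex_rel_interior_iff by blast
  have "x + (e - 1) *\<^sub>R (x - y) = (1 - e) *\<^sub>R y + e *\<^sub>R x" by (simp add: algebra_simps)
  with e that[of "e - 1"] show thesis by simp
qed

lemma tangent_cone_eq:
  fixes F P :: "'a::euclidean_space set"
  assumes "convex P" "F face_of P" "x \<in> rel_interior F"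
  shows "tangent_cone V F P = {v \<in> V. \<exists>\<epsilon>>0. x + \<epsilon> *\<^sub>R v \<in> P}"
proof -
  have step: "\<exists>\<epsilon>>0. y + \<epsilon> *\<^sub>R v \<in> P"
    if H: "x \<in> rel_interior F" "y \<in> rel_interior F" "\<epsilon> > 0" "x + \<epsilon> *\<^sub>R v \<in> P" for x y v and \<epsilon> :: real
  proof -
    have "x \<in> F" using H(1) rel_interior_subset by blast
    then obtain \<delta> where \<delta>: "\<delta> > 0" "y + \<delta> *\<^sub>R (y - x) \<in> F"
      using rel_interior_extend[OF face_of_imp_convex[OF assms(2)] H(2)] by blast
    have in_P: "y + \<delta> *\<^sub>R (y - x) \<in> P" using \<delta>(2) assms(2) face_of_imp_subset by blast
    have "(1 / (1 + \<delta>)) *\<^sub>R (y + \<delta> *\<^sub>R (y - x)) + (\<delta> / (1 + \<delta>)) *\<^sub>R (x + \<epsilon> *\<^sub>R v) \<in> P"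
      using \<delta>(1) by (intro convexD[OF assms(1) in_P H(4)]) (auto simp: field_simps)
    moreover have "(1 / (1 + \<delta>)) *\<^sub>R (y + \<delta> *\<^sub>R (y - x)) + (\<delta> / (1 + \<delta>)) *\<^sub>R (x + \<epsilon> *\<^sub>R v)
        = (1 / (1 + \<delta>)) *\<^sub>R ((1 + \<delta>) *\<^sub>R y + (\<delta> * \<epsilon>) *\<^sub>R v)"
      by (simp add: algebra_simps)
    moreover have "\<dots> = y + (\<delta> * \<epsilon> / (1 + \<delta>)) *\<^sub>R v"
      using \<delta>(1) by (simp add: scaleR_add_right)
    ultimately have "y + (\<delta> * \<epsilon> / (1 + \<delta>)) *\<^sub>R v \<in> P" by simp
    moreover have "\<delta> * \<epsilon> / (1 + \<delta>) > 0" using \<delta>(1) H(3) by simp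
    ultimately show ?thesis by blast
  qed
  have p: "rel_interior_point F \<in> rel_interior F"
    unfolding rel_interior_point_def using assms(3) by (rule someI)
  show ?thesis unfolding tangent_cone_def
    using step[OF p assms(3)] step[OF assms(3) p] by (intro Collect_cong) meson
qed

lemma normal_cone_eq:
  fixes F P :: "'a::euclidean_space set"
  assumes "F face_of P" "x \<in> rel_interior F"
  shows "normal_cone V F P = {v \<in> V. \<forall>z\<in>P. v \<bullet> (z - x) \<le> 0}"
proof -
  have step: "v \<bullet> (z - y) \<le> 0"
    if H: "x \<in> rel_interior F" "y \<in> rel_interior F" "\<forall>z\<in>P. v \<bullet> (z - x) \<le> 0" "z \<in> P" for x y z v
  proof -
    have "y \<in> F" using H(2) rel_interior_subset by blast
    then obtain \<delta> where \<delta>: "\<delta> > 0" "x + \<delta> *\<^sub>R (x - y) \<in> F"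
      using rel_interior_extend[OF face_of_imp_convex[OF assms(1)] H(1)] by blast
    then have "v \<bullet> (x + \<delta> *\<^sub>R (x - y) - x) \<le> 0"
      using H(3) assms(1) face_of_imp_subset by blast
    then have "v \<bullet> (x - y) \<le> 0" using \<delta>(1) by (simp add: mult_le_0_iff)
    moreover have "v \<bullet> (z - x) \<le> 0" using H(3,4) by blast
    ultimately show ?thesis by (simp add: inner_diff_right)
  qed
  have p: "rel_interior_point F \<in> rel_interior F"
    unfolding rel_interior_point_def using assms(2) by (rule someI)
  show ?thesis unfolding normal_cone_def
    using step[OF p assms(2)] step[OF assms(2) p] by (intro Collect_cong) meson
qed


section \<open>Solid angles\<close>

definition orthonormal_basis_of :: "'a::euclidean_space set \<Rightarrow> 'a set \<Rightarrow> bool" where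
  "orthonormal_basis_of L B \<longleftrightarrow>
     B \<subseteq> L \<and> pairwise orthogonal B \<and> (\<forall>b\<in>B. norm b = 1) \<and> span B = L"

text \<open>The law of \<open>\<Sum>b\<in>B. x\<^sub>b b\<close> with independent standard normal \<open>x\<^sub>b\<close>; by rotation
  invariance it does not depend on the orthonormal basis \<open>B\<close> of \<open>L\<close>. For \<open>L = {0}\<close> it is the
  point mass at \<open>0\<close>.\<close>

definition std_gaussian :: "'a::euclidean_space set \<Rightarrow> 'a measure" where
  "std_gaussian L = (let B = (SOME B. orthonormal_basis_of L B) in
     distr (\<Pi>\<^sub>M b\<in>B. density lborel (\<lambda>t. ennreal (std_normal_density t))) borel
       (\<lambda>x. \<Sum>b\<in>B. x b *\<^sub>R b))"

definition solid_angle :: "'a::euclidean_space set \<Rightarrow> real" where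
  "solid_angle C = measure (std_gaussian (span C)) C"

definition internal_angle :: "'a::euclidean_space set \<Rightarrow> 'a set \<Rightarrow> 'a set \<Rightarrow> real" where
  "internal_angle V F P = solid_angle (tangent_cone V F P)"

definition external_angle :: "'a::euclidean_space set \<Rightarrow> 'a set \<Rightarrow> 'a set \<Rightarrow> real" where
  "external_angle V F P = solid_angle (normal_cone V F P)"


section \<open>Orthocentric cones\<close>

text \<open>Parameters \<open>\<lambda>\<^sub>0; \<lambda>\<^sub>1, \<dots>, \<lambda>\<^sub>m\<close> are given by a number \<open>l0\<close> and a function \<open>l\<close> of which only the
  values on \<open>{1..m}\<close> matter; the signs \<open>eps\<close> likewise.\<close>

definition cond_A :: "nat \<Rightarrow> real \<Rightarrow> (nat \<Rightarrow> real) \<Rightarrow> bool" where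
  "cond_A m l0 l \<longleftrightarrow> (\<forall>i\<le>m. (l(0 := l0)) i > 0)"

definition cond_B :: "nat \<Rightarrow> real \<Rightarrow> (nat \<Rightarrow> real) \<Rightarrow> bool" where
  "cond_B m l0 l \<longleftrightarrow>
     (\<exists>i\<le>m. (l(0 := l0)) i < 0 \<and> (\<forall>j\<le>m. j \<noteq> i \<longrightarrow> (l(0 := l0)) j > 0)) \<and>
     (\<Sum>i\<le>m. (l(0 := l0)) i) < 0"

definition ortho_cov :: "real \<Rightarrow> (nat \<Rightarrow> real) \<Rightarrow> nat \<Rightarrow> nat \<Rightarrow> real" where
  "ortho_cov l0 l i j = 1 / l0 + (if i = j then 1 / l i else 0)"

text \<open>\<open>K\<close> is a realisation of \<open>C\<^sub>m(\<lambda>\<^sub>0; \<lambda>\<^sub>1, \<dots>, \<lambda>\<^sub>m; \<epsilon>\<^sub>1, \<dots>, \<epsilon>\<^sub>m)\<close> in the Euclidean space \<open>'a\<close>.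
  The library's \<open>convex_cone hull\<close> is the positive hull.\<close>

definition orthocentric_cone ::
  "nat \<Rightarrow> real \<Rightarrow> (nat \<Rightarrow> real) \<Rightarrow> (nat \<Rightarrow> real) \<Rightarrow> 'a::euclidean_space set \<Rightarrow> bool" where
  "orthocentric_cone m l0 l eps K \<longleftrightarrow>
     1 \<le> m \<and> (cond_A m l0 l \<or> cond_B m l0 l) \<and> (\<forall>i\<in>{1..m}. eps i = 1 \<or> eps i = -1) \<and>
     (\<exists>u :: nat \<Rightarrow> 'a.
        inj_on u {1..m} \<and> independent (u ` {1..m}) \<and>
        (\<forall>i\<in>{1..m}. \<forall>j\<in>{1..m}. u i \<bullet> u j = ortho_cov l0 l i j) \<and>
        K = convex_cone hull ((\<lambda>i. eps i *\<^sub>R u i) ` {1..m}))"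

text \<open>Isometry of cones with apex \<open>0\<close>: a linear isometry of the linear hulls maps one onto the
  other.\<close>

definition isometric_cones :: "'a::euclidean_space set \<Rightarrow> 'b::euclidean_space set \<Rightarrow> bool" where
  "isometric_cones C D \<longleftrightarrow>
     (\<exists>f. linear f \<and> (\<forall>x\<in>span C. norm (f x) = norm x) \<and> f ` C = D)"

text \<open>The orthocentric cone is only defined up to isometry, so the notion actually used in statements
  is being isometric to one of its realisations, hence (\<open>orthocentric_cone_unique\<close>) to all of them.
  The realisation may be taken in the space containing \<open>C\<close>: if \<open>C\<close> is isometric to a
  realisation anywhere, it is itself a realisation.\<close>

definition isometric_to_orthocentric_cone ::
  "'a::euclidean_space set \<Rightarrow> nat \<Rightarrow> real \<Rightarrow> (nat \<Rightarrow> real) \<Rightarrow> (nat \<Rightarrow> real) \<Rightarrow> bool" where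
  "isometric_to_orthocentric_cone C m l0 l eps \<longleftrightarrow>
     (\<exists>K :: 'a set. orthocentric_cone m l0 l eps K \<and> isometric_cones C K)"

lemma linear_image_convex_cone_hull_subset:
  fixes f :: "'a::real_vector \<Rightarrow> 'b::real_vector"
  assumes "linear f"
  shows "f ` (convex_cone hull S) \<subseteq> convex_cone hull (f ` S)"
proof -
  let ?T = "{x. f x \<in> convex_cone hull (f ` S)}"
  have "convex_cone ?T"
    by (rule convex_cone_iff[THEN iffD2])
       (auto simp: linear_0[OF assms] linear_add[OF assms] linear_scale[OF assms]
          convex_cone_hull_add convex_cone_hull_mul convex_cone_hull_contains_0)
  moreover have "S \<subseteq> ?T" by (auto intro: hull_inc)
  ultimately have "convex_cone hull S \<subseteq> ?T" by (intro hull_minimal)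
  then show ?thesis by blast
qed

lemma convex_cone_hull_subset_span: "convex_cone hull S \<subseteq> span S"
proof (rule hull_minimal)
  show "convex_cone (span S)"
    unfolding convex_cone_iff using span_0 span_add span_scale by blast
qed (rule span_superset)

lemma linear_image_convex_cone_hull:
  fixes f :: "'a::real_vector \<Rightarrow> 'b::real_vector"
  assumes "linear f"
  shows "f ` (convex_cone hull S) = convex_cone hull (f ` S)"
proof
  show "convex_cone hull (f ` S) \<subseteq> f ` (convex_cone hull S)"
  proof (rule hull_minimal)
    show "convex_cone (f ` (convex_cone hull S))"
      using convex_cone_linear_image convex_cone_convex_cone_hull assms by blast
  qed (use hull_subset[of S convex_cone] in blast)
qed (rule linear_image_convex_cone_hull_subset[OF assms])

lemma orthocentric_cone_unique:
  fixes K :: "'a::euclidean_space set" and K' :: "'b::euclidean_space set"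
  assumes "orthocentric_cone m l0 l eps K" "orthocentric_cone m l0 l eps K'"
  shows "isometric_cones K K'"
proof -
  obtain u :: "nat \<Rightarrow> 'a" where u: "inj_on u {1..m}" "independent (u ` {1..m})"
      "\<forall>i\<in>{1..m}. \<forall>j\<in>{1..m}. u i \<bullet> u j = ortho_cov l0 l i j"
      "K = convex_cone hull ((\<lambda>i. eps i *\<^sub>R u i) ` {1..m})"
    using assms(1) unfolding orthocentric_cone_def by blast
  obtain u' :: "nat \<Rightarrow> 'b" where u':
      "\<forall>i\<in>{1..m}. \<forall>j\<in>{1..m}. u' i \<bullet> u' j = ortho_cov l0 l i j"
      "K' = convex_cone hull ((\<lambda>i. eps i *\<^sub>R u' i) ` {1..m})"
    using assms(2) unfolding orthocentric_cone_def by blast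
  obtain f where f: "linear f" "\<forall>x\<in>u ` {1..m}. f x = u' (inv_into {1..m} u x)"
    using linear_independent_extend[OF u(2), of "\<lambda>x. u' (inv_into {1..m} u x)"] by auto
  have fu: "f (u i) = u' i" if "i \<in> {1..m}" for i
    using f(2) that inv_into_f_f[OF u(1) that] by simp
  have "f x \<bullet> f y = x \<bullet> y" if "x \<in> span (u ` {1..m})" "y \<in> span (u ` {1..m})" for x y
  proof -
    have base: "f (u i) \<bullet> f y = u i \<bullet> y" if i: "i \<in> {1..m}" for i
      using \<open>y \<in> span (u ` {1..m})\<close>
    proof (induction rule: span_induct_alt)
      case base
      then show ?case using linear_0[OF f(1)] by simp
    next
      case (step c x y)
      then show ?case using u(3) u'(1) fu i
        by (auto simp: linear_add[OF f(1)] linear_scale[OF f(1)] inner_add_right)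
    qed
    show ?thesis using that(1)
    proof (induction rule: span_induct_alt)
      case base
      then show ?case using linear_0[OF f(1)] by simp
    next
      case (step c x z)
      then show ?case using base
        by (auto simp: linear_add[OF f(1)] linear_scale[OF f(1)] inner_add_left)
    qed
  qed
  then have norm_f: "norm (f x) = norm x" if "x \<in> span (u ` {1..m})" for x
    using that by (simp add: norm_eq_sqrt_inner)
  have "K \<subseteq> span ((\<lambda>i. eps i *\<^sub>R u i) ` {1..m})"
    unfolding u(4) by (rule convex_cone_hull_subset_span)
  also have "\<dots> \<subseteq> span (u ` {1..m})"
    by (intro span_minimal subspace_span) (auto intro: span_scale span_base)
  finally have "span K \<subseteq> span (u ` {1..m})" by (intro span_minimal subspace_span)
  moreover have "f ` K = K'"
  proof -
    have "f ` ((\<lambda>i. eps i *\<^sub>R u i) ` {1..m}) = (\<lambda>i. eps i *\<^sub>R u' i) ` {1..m}"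
      by (auto simp: image_image linear_scale[OF f(1)] fu)
    then show ?thesis by (simp add: u(4) u'(2) linear_image_convex_cone_hull[OF f(1)])
  qed
  ultimately show ?thesis unfolding isometric_cones_def using f(1) norm_f by blast
qed


section \<open>The Gaussian orthant probabilities\<close>

definition centered_normal :: "'s measure \<Rightarrow> ('s \<Rightarrow> real) \<Rightarrow> real \<Rightarrow> bool" where
  "centered_normal M X v \<longleftrightarrow>
     X \<in> borel_measurable M \<and>
     (if v = 0 then (AE x in M. X x = 0)
      else v > 0 \<and> distributed M lborel X (\<lambda>t. ennreal (normal_density 0 (sqrt v) t)))"

text \<open>Centered Gaussian vector \<open>(\<eta>\<^sub>1, \<dots>, \<eta>\<^sub>m)\<close> with covariance matrix \<open>\<Sigma>\<close>: every linear combination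
  \<open>\<Sum>i. t\<^sub>i \<eta>\<^sub>i\<close> is centered normal with variance \<open>\<Sum>i j. t\<^sub>i t\<^sub>j \<Sigma>\<^sub>i\<^sub>j\<close>.\<close>

definition centered_gaussian_vector ::
  "'s measure \<Rightarrow> nat \<Rightarrow> (nat \<Rightarrow> 's \<Rightarrow> real) \<Rightarrow> (nat \<Rightarrow> nat \<Rightarrow> real) \<Rightarrow> bool" where
  "centered_gaussian_vector M m \<eta> \<Sigma> \<longleftrightarrow>
     prob_space M \<and>
     (\<forall>t :: nat \<Rightarrow> real. centered_normal M (\<lambda>x. \<Sum>i=1..m. t i * \<eta> i x)
                            (\<Sum>i=1..m. \<Sum>j=1..m. t i * t j * \<Sigma> i j))"

text \<open>The probability depends only on the joint law, which \<open>\<Sigma>\<close> determines, so it suffices to consider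
  laws on the product space with the coordinate functions as random variables.\<close>

definition gauss_orthant ::
  "nat \<Rightarrow> real \<Rightarrow> (nat \<Rightarrow> real) \<Rightarrow> (nat \<Rightarrow> real) \<Rightarrow> real" where
  "gauss_orthant m l0 l eps =
     (if m = 0 then 1
      else (THE p. \<exists>M :: (nat \<Rightarrow> real) measure.
              sets M = sets (\<Pi>\<^sub>M i\<in>{1..m}. (borel :: real measure)) \<and>
              centered_gaussian_vector M m (\<lambda>i x. x i) (ortho_cov l0 l) \<and>
              p = measure M {x \<in> space M. \<forall>i\<in>{1..m}. eps i * x i < 0}))"

end

theory Submission
  imports Defs
begin

text \<open>For a vertex \<open>a\<^sub>j\<close> of \<open>S\<close> outside a face \<open>F\<close> let \<open>z\<^sub>j\<close> be its projection orthogonal to the lineality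
  space \<open>L\<close> of \<open>F\<close> and \<open>n\<^sub>j\<close> the outward normal of the facet opposite \<open>a\<^sub>j\<close>. The two systems are
  biorthogonal up to scaling, so \<open>T(F,S) = L + pos(z\<^sub>j) = {v. n\<^sub>j \<bullet> v \<le> 0}\<close> and
  \<open>N(F,S) = pos(n\<^sub>j) = {v \<bottom> L. z\<^sub>j \<bullet> v \<le> 0}\<close>. Since \<open>w\<close> is the orthocenter of the simplex on all
  \<open>e\<^sub>i / \<tau>\<^sub>i\<close>, the vectors \<open>z\<^sub>j\<close> and \<open>n\<^sub>j\<close> are explicit and their Gram matrices have the form required of
  orthocentric cones. Applied to a standard Gaussian \<open>\<xi>\<close>, the halfspace descriptions turn the angles
  into orthant probabilities of the Gaussian vectors \<open>n\<^sub>j \<bullet> \<xi>\<close> and \<open>z\<^sub>j \<bullet> \<xi>\<close>, which have these Gram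
  matrices as covariances; \<open>THE\<close> in \<open>gauss_orthant\<close> is well defined because a law on a finite product
  of lines is determined by the laws of the linear functionals.\<close>

subsection \<open>Laws on finite products of lines\<close>

text \<open>The hypothesis at frequency 0 says that both weights have the same total mass
  \<open>c\<close>. Division by \<open>c\<close> turns them into probability densities under which
  \<open>X\<close> and \<open>Y\<close> have the same characteristic function, so Levy's uniqueness
  theorem applies. If \<open>c = 0\<close>, both weights vanish almost everywhere.\<close>

lemma weighted_integral_eq_of_char_eq:
  fixes X Y :: "_ \<Rightarrow> real" and g :: "'s \<Rightarrow> real" and h :: "'t \<Rightarrow> real"
  assumes [measurable]: "X \<in> borel_measurable M" "Y \<in> borel_measurable N"
    and g: "integrable M g" "\<And>x. 0 \<le> g x" and h: "integrable N h" "\<And>x. 0 \<le> h x"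
    and eq: "\<And>s. (CLINT x|M. g x * iexp (s * X x)) = (CLINT x|N. h x * iexp (s * Y x))"
    and A: "A \<in> sets borel"
  shows "(LINT x|M. g x * indicator A (X x)) = (LINT x|N. h x * indicator A (Y x))"
proof -
  have [measurable]: "g \<in> borel_measurable M" "h \<in> borel_measurable N" "A \<in> sets borel"
    using g h A by auto
  define c where "c = (LINT x|M. g x)"
  have "complex_of_real (LINT x|M. g x) = complex_of_real (LINT x|N. h x)"
    using eq[of 0] by simp
  then have c': "c = (LINT x|N. h x)" by (simp add: c_def)
  show ?thesis
  proof (cases "c = 0")
    case True
    then have "AE x in M. g x = 0" "AE x in N. h x = 0"
      using integral_nonneg_eq_0_iff_AE[OF g(1)] integral_nonneg_eq_0_iff_AE[OF h(1)] g(2) h(2) c_def c'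
      by auto
    then have "(LINT x|M. g x * indicator A (X x)) = 0" "(LINT x|N. h x * indicator A (Y x)) = 0"
      by (auto intro!: integral_eq_zero_AE)
    then show ?thesis by simp
  next
    case False
    have "c \<ge> 0" unfolding c_def using g by (intro integral_nonneg_AE) auto
    with False have c: "c > 0" by simp
    have rd: "real_distribution (distr (density P (\<lambda>x. ennreal (f x / c))) borel Z)"
      if "integrable P f" "\<And>x. 0 \<le> f x" "(LINT x|P. f x) = c" "Z \<in> borel_measurable P"
      for P :: "'x measure" and f :: "'x \<Rightarrow> real" and Z :: "'x \<Rightarrow> real"
    proof -
      have [measurable]: "f \<in> borel_measurable P" "Z \<in> borel_measurable P" using that by auto
      have "(\<integral>\<^sup>+x. ennreal (f x / c) \<partial>P) = ennreal (LINT x|P. f x / c)"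
        using that c by (intro nn_integral_eq_integral) auto
      also have "\<dots> = 1" using that(3) c by simp
      finally have "prob_space (density P (\<lambda>x. ennreal (f x / c)))"
        by (intro prob_spaceI) (simp add: emeasure_density cong: nn_integral_cong)
      then show ?thesis by (intro prob_space.real_distribution_distr) simp_all
    qed
    have ch: "char (distr (density P (\<lambda>x. ennreal (f x / c))) borel Z) s = (CLINT x|P. f x * iexp (s * Z x)) / c"
      if "integrable P f" "\<And>x. 0 \<le> f x" "Z \<in> borel_measurable P"
      for P :: "'x measure" and f :: "'x \<Rightarrow> real" and Z :: "'x \<Rightarrow> real" and s
    proof -
      have [measurable]: "f \<in> borel_measurable P" "Z \<in> borel_measurable P" using that by auto
      have "char (distr (density P (\<lambda>x. ennreal (f x / c))) borel Z) s = (CLINT x|P. (f x / c) *\<^sub>R iexp (s * Z x))"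
        unfolding char_def using that c by (subst integral_distr; simp add: integral_density)
      also have "\<dots> = (CLINT x|P. (f x * iexp (s * Z x)) / c)"
        by (intro Bochner_Integration.integral_cong) (auto simp: scaleR_conv_of_real)
      finally show ?thesis by simp
    qed
    have "distr (density M (\<lambda>x. ennreal (g x / c))) borel X = distr (density N (\<lambda>x. ennreal (h x / c))) borel Y"
    proof (rule Levy_uniqueness)
      show "real_distribution (distr (density M (\<lambda>x. ennreal (g x / c))) borel X)"
        by (intro rd g) (simp_all add: c_def)
      show "real_distribution (distr (density N (\<lambda>x. ennreal (h x / c))) borel Y)"
        by (intro rd h) (simp_all add: c')
      show "char (distr (density M (\<lambda>x. ennreal (g x / c))) borel X) = char (distr (density N (\<lambda>x. ennreal (h x / c))) borel Y)"
        by (rule ext) (simp only: ch[OF g assms(1)] ch[OF h assms(2)] eq)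
    qed
    then have "(LINT y|distr (density M (\<lambda>x. ennreal (g x / c))) borel X. indicator A y :: real)
      = (LINT y|distr (density N (\<lambda>x. ennreal (h x / c))) borel Y. indicator A y)" by simp
    then have "(LINT x|M. (g x / c) * indicator A (X x)) = (LINT x|N. (h x / c) * indicator A (Y x))"
      using c g(2) h(2) by (subst (asm) (1 2) integral_distr; simp add: integral_density)
    then show ?thesis using c by simp
  qed
qed

lemma integral_of_real_plus_ii:
  assumes "integrable M f" "integrable M g"
  shows "(CLINT x|M. complex_of_real (f x) + \<i> * complex_of_real (g x)) =
    complex_of_real (LINT x|M. f x) + \<i> * complex_of_real (LINT x|M. g x)"
  using assms by simp

text \<open>The measures with density \<open>h\<close> with respect to \<open>M\<close> and
  \<open>N\<close> have equal Fourier transforms. This is the invariant that survives restricting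
  one coordinate to a Borel set; the bounds on \<open>h\<close> keep the integrands integrable
  against finite measures.\<close>

definition same_fourier ::
  "'i set \<Rightarrow> ('i \<Rightarrow> real) measure \<Rightarrow> ('i \<Rightarrow> real) measure \<Rightarrow> (('i \<Rightarrow> real) \<Rightarrow> real) \<Rightarrow> bool" where
  "same_fourier I M N h \<longleftrightarrow>
    h \<in> borel_measurable (\<Pi>\<^sub>M i\<in>I. borel) \<and> (\<forall>x. 0 \<le> h x \<and> h x \<le> 1) \<and>
    (\<forall>t. (CLINT x|M. h x * iexp (\<Sum>i\<in>I. t i * x i)) = (CLINT x|N. h x * iexp (\<Sum>i\<in>I. t i * x i)))"

text \<open>Weighting with \<open>h \<cdot> (1 + cos (t \<bullet> x + a))\<close>, which is nonnegative, reduces the claim to Levy's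
  uniqueness theorem for the law of the single coordinate \<open>j\<close>; the phases \<open>a = 0\<close> and \<open>a = - pi / 2\<close>
  recover the real and the imaginary part.\<close>

lemma same_fourier_indicator:
  fixes I :: "'i set"
  assumes I: "finite I" "j \<in> I" and A: "A \<in> sets borel"
    and "prob_space M" "prob_space N" and sets: "sets M = sets (\<Pi>\<^sub>M i\<in>I. borel)" "sets N = sets (\<Pi>\<^sub>M i\<in>I. borel)"
    and H: "same_fourier I M N h"
  shows "same_fourier I M N (\<lambda>x. h x * indicator A (x j))"
proof -
  interpret M: prob_space M by fact
  interpret N: prob_space N by fact
  note [measurable_cong] = sets
  note [measurable] = A I(2)
  have hm[measurable]: "h \<in> borel_measurable (\<Pi>\<^sub>M i\<in>I. borel)" and h: "\<And>x. 0 \<le> h x" "\<And>x. h x \<le> 1"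
    and heq: "\<And>t. (CLINT x|M. h x * iexp (\<Sum>i\<in>I. t i * x i)) = (CLINT x|N. h x * iexp (\<Sum>i\<in>I. t i * x i))"
    using H by (auto simp: same_fourier_def)
  let ?X = "\<lambda>t x. \<Sum>i\<in>I. t i * x i"
  have ih: "integrable P h" if "finite_measure P" "sets P = sets (\<Pi>\<^sub>M i\<in>I. borel)" for P
  proof -
    interpret finite_measure P by fact
    note [measurable_cong] = that(2)
    show ?thesis by (rule integrable_const_bound[of _ 1]) (use h in auto)
  qed
  have ihc: "integrable P (\<lambda>x. h x * (f x :: complex))"
    if "finite_measure P" "sets P = sets (\<Pi>\<^sub>M i\<in>I. borel)" "f \<in> borel_measurable P" "\<And>x. norm (f x) \<le> 1" for P f
  proof -
    note [measurable_cong] = that(2)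
    note [measurable] = that(3)
    show ?thesis
      by (rule Bochner_Integration.integrable_bound[OF ih[OF that(1,2)]])
         (use h that(4) in \<open>auto simp: norm_mult intro!: mult_right_le_one_le\<close>)
  qed
  have ihr: "integrable P (\<lambda>x. h x * (f x :: real))"
    if "finite_measure P" "sets P = sets (\<Pi>\<^sub>M i\<in>I. borel)" "f \<in> borel_measurable P" "\<And>x. norm (f x) \<le> 1" for P f
  proof -
    note [measurable_cong] = that(2)
    note [measurable] = that(3)
    show ?thesis
      by (rule Bochner_Integration.integrable_bound[OF ih[OF that(1,2)]])
         (use h that(4) in \<open>auto simp: abs_mult intro!: mult_right_le_one_le\<close>)
  qed
  have fm: "finite_measure M" "finite_measure N" by unfold_locales
  \<comment> \<open>The unit vector at \<open>j\<close>: it makes \<open>x j\<close> a linear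
    functional, so that frequencies in the single coordinate \<open>j\<close> are covered by
    \<open>heq\<close>.\<close>
  define J :: "'i \<Rightarrow> real" where "J i = (if i = j then 1 else 0)" for i
  have J: "x j = ?X J x" for x :: "'i \<Rightarrow> real"
    using I by (simp add: J_def if_distrib[of "\<lambda>a. a * _"] sum.delta' cong: if_cong)
  have one: "(LINT x|M. h x * indicator A (x j)) = (LINT x|N. h x * indicator A (x j))"
  proof (rule weighted_integral_eq_of_char_eq[where X = "\<lambda>x. x j" and Y = "\<lambda>x. x j"])
    fix s
    have "s * x j = ?X (\<lambda>i. s * J i) x" for x unfolding J[of x] by (simp add: sum_distrib_left mult.assoc)
    then show "(CLINT x|M. h x * iexp (s * x j)) = (CLINT x|N. h x * iexp (s * x j))"
      using heq[of "\<lambda>i. s * J i"] by simp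
  qed (use ih fm sets h in auto)
  have cosshift: "(LINT x|M. h x * indicator A (x j) * cos (?X t x + a)) = (LINT x|N. h x * indicator A (x j) * cos (?X t x + a))" for t a
  proof -
    \<comment> \<open>By Euler's formula the cosine shifts the frequency by \<open>t\<close> and by
      \<open>- t\<close>, so each of the three integrals is one on which \<open>M\<close> and
      \<open>N\<close> agree by \<open>heq\<close>.\<close>
    have exp: "(CLINT x|P. complex_of_real (h x * (1 + cos (?X t x + a))) * iexp (s * x j)) =
        (CLINT x|P. h x * iexp (?X (\<lambda>i. s * J i) x)) + iexp a / 2 * (CLINT x|P. h x * iexp (?X (\<lambda>i. s * J i + t i) x))
           + iexp (-a) / 2 * (CLINT x|P. h x * iexp (?X (\<lambda>i. s * J i - t i) x))"
      if P: "finite_measure P" "sets P = sets (\<Pi>\<^sub>M i\<in>I. borel)" for P s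
    proof -
      note [measurable_cong] = that(2)
      have "complex_of_real (h x * (1 + cos (?X t x + a))) * iexp (s * x j) =
        h x * iexp (?X (\<lambda>i. s * J i) x) + iexp a / 2 * (h x * iexp (?X (\<lambda>i. s * J i + t i) x))
           + iexp (-a) / 2 * (h x * iexp (?X (\<lambda>i. s * J i - t i) x))" for x
      proof -
        define y where "y = ?X t x"
        have e: "?X (\<lambda>i. s * J i) x = s * x j" "?X (\<lambda>i. s * J i + t i) x = s * x j + y" "?X (\<lambda>i. s * J i - t i) x = s * x j - y"
          unfolding J[of x] by (simp_all add: y_def sum_distrib_left mult.assoc sum.distrib sum_subtractf algebra_simps)
        have c: "complex_of_real (cos (y + a)) = (iexp (y + a) + iexp (-(y + a))) / 2"
          unfolding cos_of_real[symmetric] cos_exp_eq by (simp add: algebra_simps)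
        show ?thesis unfolding e y_def[symmetric] of_real_mult of_real_add c
          by (simp add: exp_add exp_diff exp_minus field_simps)
      qed
      then show ?thesis
        using P by (simp add: ihc del: of_real_sum of_real_mult of_real_add)
    qed
    have "(LINT x|M. h x * (1 + cos (?X t x + a)) * indicator A (x j)) = (LINT x|N. h x * (1 + cos (?X t x + a)) * indicator A (x j))"
    proof (rule weighted_integral_eq_of_char_eq[where X = "\<lambda>x. x j" and Y = "\<lambda>x. x j"])
      show "integrable M (\<lambda>x. h x * (1 + cos (?X t x + a)))"
        using ih[of M] ihr[of M "\<lambda>x. cos (?X t x + a)"] fm sets by (simp add: algebra_simps)
      show "integrable N (\<lambda>x. h x * (1 + cos (?X t x + a)))"
        using ih[of N] ihr[of N "\<lambda>x. cos (?X t x + a)"] fm sets by (simp add: algebra_simps)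
      show "0 \<le> h x * (1 + cos (?X t x + a))" for x
        using h(1)[of x] cos_ge_minus_one[of "?X t x + a"] by (intro mult_nonneg_nonneg) linarith+
      then show "0 \<le> h x * (1 + cos (?X t x + a))" for x .
      show "(CLINT x|M. complex_of_real (h x * (1 + cos (?X t x + a))) * iexp (s * x j)) =
        (CLINT x|N. complex_of_real (h x * (1 + cos (?X t x + a))) * iexp (s * x j))" for s
        by (simp only: exp[OF fm(1) sets(1)] exp[OF fm(2) sets(2)] heq)
    qed (use A in auto)
    \<comment> \<open>The summand 1 in the weight secures nonnegativity; its contribution agrees for
      both measures by \<open>one\<close> and cancels.\<close>
    moreover have "(LINT x|P. h x * (1 + cos (?X t x + a)) * indicator A (x j)) =
      (LINT x|P. h x * indicator A (x j)) + (LINT x|P. h x * indicator A (x j) * cos (?X t x + a))"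
      if P: "finite_measure P" "sets P = sets (\<Pi>\<^sub>M i\<in>I. borel)" for P
    proof -
      note [measurable_cong] = that(2)
      have "integrable P (\<lambda>x. h x * indicator A (x j))" "integrable P (\<lambda>x. h x * (indicator A (x j) * cos (?X t x + a)))"
        using P by (intro ihr; auto simp: indicator_def)+
      then show ?thesis
        by (subst Bochner_Integration.integral_add[symmetric]) (auto simp: algebra_simps)
    qed
    ultimately show ?thesis using one fm sets by simp
  qed
  have split: "(CLINT x|P. complex_of_real (h x * indicator A (x j)) * iexp (?X t x)) =
    complex_of_real (LINT x|P. h x * indicator A (x j) * cos (?X t x + 0)) +
    \<i> * complex_of_real (LINT x|P. h x * indicator A (x j) * cos (?X t x + (- pi / 2)))"
    if P: "finite_measure P" "sets P = sets (\<Pi>\<^sub>M i\<in>I. borel)" for P t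
  proof -
    note [measurable_cong] = that(2)
    have i: "integrable P (\<lambda>x. h x * indicator A (x j) * cos (?X t x + a))" for a
      using P ihr[of P "\<lambda>x. indicator A (x j) * cos (?X t x + a)"]
      by (auto simp: indicator_def mult.assoc)
    have "(CLINT x|P. complex_of_real (h x * indicator A (x j)) * iexp (?X t x)) =
      (CLINT x|P. complex_of_real (h x * indicator A (x j) * cos (?X t x + 0)) +
        \<i> * complex_of_real (h x * indicator A (x j) * cos (?X t x + (- pi / 2))))"
    proof (intro Bochner_Integration.integral_cong refl)
      fix x
      have "iexp y = complex_of_real (cos (y + 0)) + \<i> * complex_of_real (cos (y + (- pi/2)))" for y :: real
        using sin_cos_eq[of y] cos_minus[of "y - pi/2"]
        by (simp add: cis_conv_exp[symmetric] complex_eq_iff)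
      then show "complex_of_real (h x * indicator A (x j)) * iexp (?X t x) = complex_of_real (h x * indicator A (x j) * cos (?X t x + 0)) +
        \<i> * complex_of_real (h x * indicator A (x j) * cos (?X t x + (- pi / 2)))"
        by (simp only: of_real_mult) (simp only: algebra_simps)
    qed
    then show ?thesis by (simp only: integral_of_real_plus_ii[OF i i])
  qed
  show ?thesis
    unfolding same_fourier_def
  proof (intro conjI allI)
    show "(CLINT x|M. complex_of_real (h x * indicator A (x j)) * iexp (?X t x)) =
        (CLINT x|N. complex_of_real (h x * indicator A (x j)) * iexp (?X t x))" for t
      by (simp only: split[OF fm(1) sets(1)] split[OF fm(2) sets(2)] cosshift)
  qed (use h in \<open>auto simp: indicator_def\<close>)
qed

text \<open>Coordinates are restricted one after another, starting from the weight 1.\<close>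

lemma same_fourier_prod_indicator:
  assumes I: "finite I" and J: "J \<subseteq> I" and A: "\<And>j. j \<in> J \<Longrightarrow> A j \<in> sets borel"
    and P: "prob_space M" "prob_space N" and sets: "sets M = sets (\<Pi>\<^sub>M i\<in>I. borel)" "sets N = sets (\<Pi>\<^sub>M i\<in>I. borel)"
    and 1: "same_fourier I M N (\<lambda>_. 1)"
  shows "same_fourier I M N (\<lambda>x. \<Prod>j\<in>J. indicator (A j) (x j))"
  using finite_subset[OF J I] J A
proof (induction J rule: finite_induct)
  case empty
  then show ?case using 1 by simp
next
  case (insert j J)
  then have "same_fourier I M N (\<lambda>x. (\<Prod>j\<in>J. indicator (A j) (x j)) * indicator (A j) (x j))"
    by (intro same_fourier_indicator[OF I _ _ P sets]) auto
  then show ?case using insert by (simp add: mult.commute)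
qed

text \<open>At frequency 0 the products of indicators integrate to the masses of boxes, and the
  boxes form an intersection-stable generator of the product sigma-algebra.\<close>

lemma measure_eqI_fourier:
  fixes I :: "'i set"
  assumes I: "finite I" and P: "prob_space M" "prob_space N"
    and sets: "sets M = sets (\<Pi>\<^sub>M i\<in>I. borel)" "sets N = sets (\<Pi>\<^sub>M i\<in>I. borel)"
    and eq: "\<And>t. (CLINT x|M. iexp (\<Sum>i\<in>I. t i * x i)) = (CLINT x|N. iexp (\<Sum>i\<in>I. t i * x i))"
  shows "M = N"
proof (rule measure_eqI_PiM_finite[OF I sets])
  interpret M: prob_space M by fact
  interpret N: prob_space N by fact
  have space: "space M = (\<Pi>\<^sub>E i\<in>I. UNIV)" "space N = (\<Pi>\<^sub>E i\<in>I. UNIV)"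
    using sets_eq_imp_space_eq[OF sets(1)] sets_eq_imp_space_eq[OF sets(2)] by (auto simp: space_PiM)
  have 1: "same_fourier I M N (\<lambda>_. 1)" using eq by (simp add: same_fourier_def)
  fix A :: "'i \<Rightarrow> real set" assume A: "\<And>i. i \<in> I \<Longrightarrow> A i \<in> sets borel"
  have box: "Pi\<^sub>E I A \<in> sets (\<Pi>\<^sub>M i\<in>I. borel)" using I A by (intro sets_PiM_I_finite) auto
  have ind: "(\<Prod>j\<in>I. indicator (A j) (x j)) = (indicator (Pi\<^sub>E I A) x :: real)" if "x \<in> (\<Pi>\<^sub>E i\<in>I. UNIV)" for x
    using that I by (auto simp: indicator_def PiE_def Pi_def prod_eq_1_iff split: if_splits)
  have "(CLINT x|M. complex_of_real (\<Prod>j\<in>I. indicator (A j) (x j))) = (CLINT x|N. complex_of_real (\<Prod>j\<in>I. indicator (A j) (x j)))"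
  proof -
    have "same_fourier I M N (\<lambda>x. \<Prod>j\<in>I. indicator (A j) (x j))"
      by (rule same_fourier_prod_indicator[OF I order_refl _ P sets 1]) (rule A)
    then show ?thesis
      unfolding same_fourier_def by (elim conjE allE[of _ "\<lambda>_. 0"]) simp
  qed
  then have "(LINT x|M. (\<Prod>j\<in>I. indicator (A j) (x j) :: real)) = (LINT x|N. (\<Prod>j\<in>I. indicator (A j) (x j)))"
    unfolding integral_complex_of_real by (simp only: of_real_eq_iff)
  also have "(LINT x|M. (\<Prod>j\<in>I. indicator (A j) (x j) :: real)) = (LINT x|M. indicator (Pi\<^sub>E I A) x)"
    by (intro Bochner_Integration.integral_cong refl ind) (simp add: space)
  also have "(LINT x|N. (\<Prod>j\<in>I. indicator (A j) (x j) :: real)) = (LINT x|N. indicator (Pi\<^sub>E I A) x)"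
    by (intro Bochner_Integration.integral_cong refl ind) (simp add: space)
  finally show "emeasure M (Pi\<^sub>E I A) = emeasure N (Pi\<^sub>E I A)"
    using box sets by (simp add: M.emeasure_eq_measure N.emeasure_eq_measure)
next
  interpret M: prob_space M by fact
  show "range (\<lambda>n::nat. \<Pi>\<^sub>E i\<in>I. UNIV) \<subseteq> prod_algebra I (\<lambda>i. borel :: real measure)"
    using I by (auto intro!: prod_algebraI_finite)
  show "(\<Union>n::nat. \<Pi>\<^sub>E i\<in>I. UNIV) = space (\<Pi>\<^sub>M i\<in>I. borel :: real measure)" by (auto simp: space_PiM)
  show "emeasure M (\<Pi>\<^sub>E i\<in>I. UNIV) \<noteq> \<infinity>" by simp
qed

section \<open>Centered Gaussian vectors and uniqueness of their law\<close>

lemma centered_normal_char_eq: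
  assumes "prob_space M" "prob_space N" "centered_normal M X v" "centered_normal N Y v"
  shows "(CLINT x|M. iexp (X x)) = (CLINT x|N. iexp (Y x))"
proof (cases "v = 0")
  \<comment> \<open>In the degenerate case there is no density to compare; both variables vanish
    almost everywhere and both integrals are 1.\<close>
  case True
  interpret M: prob_space M by fact
  interpret N: prob_space N by fact
  note [measurable] = assms(3,4)[unfolded centered_normal_def, THEN conjunct1]
  have "(CLINT x|M. iexp (X x)) = (CLINT x|M. 1)"
    using assms(3) True by (intro integral_cong_AE) (auto simp: centered_normal_def)
  moreover have "(CLINT x|N. iexp (Y x)) = (CLINT x|N. 1)"
    using assms(4) True by (intro integral_cong_AE) (auto simp: centered_normal_def)
  ultimately show ?thesis by (simp add: M.prob_space N.prob_space)
next
  case False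
  note [measurable] = assms(3,4)[unfolded centered_normal_def, THEN conjunct1]
  have "distr M lborel X = distr N lborel Y"
    using assms(3,4) False by (simp add: centered_normal_def distributed_def)
  then have "(CLINT y|distr M lborel X. iexp y) = (CLINT y|distr N lborel Y. iexp y)" by simp
  then show ?thesis by (simp add: integral_distr)
qed

text \<open>The Fourier transform of the joint law at \<open>t\<close> is the expectation of
  \<open>iexp\<close> of the combination with coefficients \<open>t\<close>, and the law of that
  combination is fixed by \<open>\<Sigma>\<close>.\<close>

lemma centered_gaussian_vector_unique:
  assumes "centered_gaussian_vector M m (\<lambda>i x. x i) \<Sigma>" "centered_gaussian_vector N m (\<lambda>i x. x i) \<Sigma>"
    and sets: "sets M = sets (\<Pi>\<^sub>M i\<in>{1..m}. borel)" "sets N = sets (\<Pi>\<^sub>M i\<in>{1..m}. borel)"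
  shows "M = N"
proof -
  have P: "prob_space M" "prob_space N" using assms by (simp_all add: centered_gaussian_vector_def)
  show ?thesis
  proof (rule measure_eqI_fourier[OF _ P sets])
    fix t :: "nat \<Rightarrow> real"
    show "(CLINT x|M. iexp (\<Sum>i = 1..m. t i * x i)) = (CLINT x|N. iexp (\<Sum>i = 1..m. t i * x i))"
      using assms by (intro centered_normal_char_eq[OF P]) (auto simp: centered_gaussian_vector_def)
  qed simp
qed

text \<open>Uniqueness of the law makes the description by \<open>THE\<close> unambiguous, so any
  single realisation on the product space yields the value.\<close>

lemma gauss_orthant_eqI:
  assumes "m \<noteq> 0" "sets M = sets (\<Pi>\<^sub>M i\<in>{1..m}. borel)"
    and "centered_gaussian_vector M m (\<lambda>i x. x i) (ortho_cov l0 l)"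
  shows "gauss_orthant m l0 l eps = measure M {x \<in> space M. \<forall>i\<in>{1..m}. eps i * x i < 0}"
  unfolding gauss_orthant_def
proof (subst if_not_P[OF assms(1)], rule the_equality)
  show "\<exists>N. sets N = sets (\<Pi>\<^sub>M i\<in>{1..m}. borel) \<and> centered_gaussian_vector N m (\<lambda>i x. x i) (ortho_cov l0 l) \<and>
      measure M {x \<in> space M. \<forall>i\<in>{1..m}. eps i * x i < 0} = measure N {x \<in> space N. \<forall>i\<in>{1..m}. eps i * x i < 0}"
    using assms by blast
next
  fix p assume "\<exists>N. sets N = sets (\<Pi>\<^sub>M i\<in>{1..m}. borel) \<and> centered_gaussian_vector N m (\<lambda>i x. x i) (ortho_cov l0 l) \<and>
      p = measure N {x \<in> space N. \<forall>i\<in>{1..m}. eps i * x i < 0}"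
  then obtain N where "sets N = sets (\<Pi>\<^sub>M i\<in>{1..m}. borel)" "centered_gaussian_vector N m (\<lambda>i x. x i) (ortho_cov l0 l)"
      and p: "p = measure N {x \<in> space N. \<forall>i\<in>{1..m}. eps i * x i < 0}" by blast
  then have "N = M" using centered_gaussian_vector_unique assms(2,3) by blast
  with p show "p = measure M {x \<in> space M. \<forall>i\<in>{1..m}. eps i * x i < 0}" by simp
qed

subsection \<open>The standard Gaussian law on a subspace\<close>

lemma orthonormal_basis_of_some:
  assumes "subspace L"
  shows "orthonormal_basis_of L (SOME B. orthonormal_basis_of L B)"
proof -
  obtain B where "orthonormal_basis_of L B"
    using orthonormal_basis_subspace[OF assms] unfolding orthonormal_basis_of_def by metis
  then show ?thesis by (rule someI)
qed

text \<open>Independence means that the joint law is the product of the marginal laws; the joint law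
  of the coordinates is the product measure itself.\<close>

lemma indep_vars_PiM_coordinates:
  assumes "I \<noteq> {}" "\<And>i. i \<in> I \<Longrightarrow> prob_space (M i)"
  shows "prob_space.indep_vars (PiM I M) M (\<lambda>i x. x i) I"
proof -
  interpret prob_space "PiM I M" by (intro prob_space_PiM assms)
  have "distr (PiM I M) (PiM I M) (\<lambda>x. \<lambda>i\<in>I. x i) = distr (PiM I M) (PiM I M) (\<lambda>x. x)"
    by (intro distr_cong) (auto simp: space_PiM)
  also have "\<dots> = PiM I (\<lambda>i. distr (PiM I M) (M i) (\<lambda>x. x i))"
    unfolding distr_id by (rule PiM_cong) (simp_all add: distr_PiM_component assms(2))
  finally show ?thesis
    by (subst indep_vars_iff_distr_eq_PiM'[OF assms(1)]) auto
qed

lemma centered_normal_PiM_std_normal: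
  fixes c :: "'i \<Rightarrow> real"
  assumes B: "finite B"
  shows "centered_normal (\<Pi>\<^sub>M b\<in>B. std_normal_distribution)
    (\<lambda>x. \<Sum>b\<in>B. x b * c b) (\<Sum>b\<in>B. (c b)\<^sup>2)"
proof -
  let ?N = "std_normal_distribution"
  let ?P = "\<Pi>\<^sub>M b\<in>B. ?N"
  have pN: "prob_space ?N" by (rule prob_space_normal_density) simp
  interpret P: prob_space ?P by (intro prob_space_PiM pN)
  have [measurable_cong]: "sets ?P = sets (\<Pi>\<^sub>M b\<in>B. borel)" by (intro sets_PiM_cong) auto
  \<comment> \<open>Zero coefficients are dropped because a normal density requires positive
    variance; if none remain, the sum is identically 0.\<close>
  define B' where "B' = {b\<in>B. c b \<noteq> 0}"
  have fB': "finite B'" "B' \<subseteq> B" using B by (auto simp: B'_def)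
  have sums: "(\<Sum>b\<in>B. x b * c b) = (\<Sum>b\<in>B'. x b * c b)" "(\<Sum>b\<in>B. (c b)\<^sup>2) = (\<Sum>b\<in>B'. (c b)\<^sup>2)" for x
    using B by (auto simp: B'_def intro!: sum.mono_neutral_right)
  show ?thesis
  proof (cases "B' = {}")
    case True
    then show ?thesis by (simp add: centered_normal_def sums)
  next
    case False
    then have "B \<noteq> {}" using fB' by auto
    have ind0: "P.indep_vars (\<lambda>_. ?N) (\<lambda>i x. x i) B'"
      using P.indep_vars_subset[OF indep_vars_PiM_coordinates[OF \<open>B \<noteq> {}\<close>, of "\<lambda>_. ?N"] fB'(2)] pN by simp
    have ind: "P.indep_vars (\<lambda>_. borel) (\<lambda>b x. x b * c b) B'"
      by (rule P.indep_vars_compose2[OF ind0, where Y = "\<lambda>b y. y * c b"]) simp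
    have "distributed ?P lborel (\<lambda>x. x b) std_normal_density" if "b \<in> B'" for b
    proof -
      have "b \<in> B" using that fB' by auto
      then have "distr ?P lborel (\<lambda>x. x b) = distr ?P ?N (\<lambda>x. x b)" by (intro distr_cong) auto
      also have "\<dots> = ?N" by (rule distr_PiM_component[OF pN \<open>b \<in> B\<close>])
      finally show ?thesis using \<open>b \<in> B\<close> by (simp add: distributed_def)
    qed
    then have "distributed ?P lborel (\<lambda>x. x b * c b) (normal_density 0 \<bar>c b\<bar>)" if "b \<in> B'" for b
      using P.normal_density_affine[of "\<lambda>x. x b" 0 1 "c b" 0] that
      by (simp add: B'_def mult.commute)
    then have "distributed ?P lborel (\<lambda>x. \<Sum>b\<in>B'. x b * c b) (normal_density (\<Sum>b\<in>B'. 0) (sqrt (\<Sum>b\<in>B'. \<bar>c b\<bar>\<^sup>2)))"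
      by (intro P.sum_indep_normal[OF fB'(1) False ind]) (auto simp: B'_def)
    moreover have "(\<Sum>b\<in>B'. (c b)\<^sup>2) > 0"
      using False fB' by (intro sum_pos) (auto simp: B'_def)
    ultimately show ?thesis
      unfolding centered_normal_def sums using distributed_measurable by force
  qed
qed

lemma std_gaussian_basis:
  assumes "subspace L"
  obtains B where "finite B" "orthonormal_basis_of L B"
    "std_gaussian L = distr (\<Pi>\<^sub>M b\<in>B. std_normal_distribution) borel
       (\<lambda>x. \<Sum>b\<in>B. x b *\<^sub>R b)"
proof -
  define B where "B = (SOME B. orthonormal_basis_of L B)"
  have B: "orthonormal_basis_of L B" unfolding B_def by (rule orthonormal_basis_of_some[OF assms])
  then have "pairwise orthogonal B" "0 \<notin> B" by (auto simp: orthonormal_basis_of_def)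
  then have "finite B" using independent_imp_finite pairwise_orthogonal_independent by blast
  with B that show thesis by (auto simp: std_gaussian_def B_def Let_def)
qed

lemma measurable_std_gaussian_sum:
  fixes B :: "'a::euclidean_space set"
  shows "(\<lambda>x. \<Sum>b\<in>B. x b *\<^sub>R b) \<in> borel_measurable (\<Pi>\<^sub>M b\<in>B. std_normal_distribution)"
proof -
  have [measurable_cong]: "sets (\<Pi>\<^sub>M b\<in>B. std_normal_distribution) = sets (\<Pi>\<^sub>M b\<in>B. borel)"
    by (intro sets_PiM_cong) auto
  show ?thesis by measurable
qed

lemma prob_space_std_gaussian:
  assumes "subspace L"
  shows "prob_space (std_gaussian L)"
proof -
  obtain B where "finite B" "orthonormal_basis_of L B"
    and B: "std_gaussian L = distr (\<Pi>\<^sub>M b\<in>B. std_normal_distribution) borel (\<lambda>x. \<Sum>b\<in>B. x b *\<^sub>R b)"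
    by (rule std_gaussian_basis[OF assms])
  show ?thesis unfolding B
    by (intro prob_space.prob_space_distr prob_space_PiM prob_space_normal_density measurable_std_gaussian_sum) simp
qed

lemma sets_std_gaussian [simp, measurable_cong]: "sets (std_gaussian L) = sets borel"
  by (simp add: std_gaussian_def Let_def)

lemma space_std_gaussian [simp]: "space (std_gaussian L) = UNIV"
  by (simp add: std_gaussian_def Let_def)

lemma measure_std_gaussian_self:
  fixes L :: "'a::euclidean_space set"
  assumes "subspace L"
  shows "measure (std_gaussian L) L = 1"
proof -
  obtain B where "finite B" and B: "orthonormal_basis_of L B"
      "std_gaussian L = distr (\<Pi>\<^sub>M b\<in>B. std_normal_distribution) borel (\<lambda>x. \<Sum>b\<in>B. x b *\<^sub>R b)"
    by (rule std_gaussian_basis[OF assms])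
  interpret P: prob_space "\<Pi>\<^sub>M b\<in>B. std_normal_distribution"
    by (intro prob_space_PiM prob_space_normal_density) simp
  have "L \<in> sets borel" using closed_subspace[OF assms] by auto
  moreover have "(\<lambda>x. \<Sum>b\<in>B. x b *\<^sub>R b) -` L = UNIV"
    using B(1) assms by (auto simp: orthonormal_basis_of_def intro!: subspace_sum subspace_scale)
  ultimately show ?thesis unfolding B(2)
    by (simp add: measure_distr[OF measurable_std_gaussian_sum] P.prob_space)
qed

lemma AE_std_gaussian:
  assumes "subspace L"
  shows "AE x in std_gaussian L. x \<in> L"
proof -
  interpret prob_space "std_gaussian L" by (rule prob_space_std_gaussian[OF assms])
  have "L \<in> sets borel" using closed_subspace[OF assms] by auto
  then show ?thesis using measure_std_gaussian_self[OF assms]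
    by (subst prob_eq_1[symmetric]) auto
qed

text \<open>The sum arises as the variance of a linear functional in the chosen basis; the identity
  removes the dependence on that basis.\<close>

lemma orthonormal_basis_of_parseval:
  assumes B: "orthonormal_basis_of L B" "finite B" and a: "a \<in> L"
  shows "(\<Sum>b\<in>B. (a \<bullet> b)\<^sup>2) = a \<bullet> a"
proof -
  have b: "b \<bullet> b = 1" "b \<noteq> 0" if "b \<in> B" for b using B that by (auto simp: orthonormal_basis_of_def dot_square_norm)
  have o: "b \<bullet> c = 0" if "b \<in> B" "c \<in> B" "b \<noteq> c" for b c
    using B that by (auto simp: orthonormal_basis_of_def pairwise_def orthogonal_def)
  obtain u where u: "a = (\<Sum>v\<in>B. u v *\<^sub>R v)"
  proof -
    have "a \<in> range (\<lambda>u. \<Sum>v\<in>B. u v *\<^sub>R v)"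
      using a B span_finite[OF B(2)] by (simp add: orthonormal_basis_of_def)
    then show thesis using that by blast
  qed
  have ab: "a \<bullet> b = u b" if "b \<in> B" for b
  proof -
    have "a \<bullet> b = (\<Sum>v\<in>B. if v = b then u b else 0)"
      unfolding u inner_sum_left using that b o by (intro sum.cong) auto
    also have "\<dots> = u b" using B(2) that by simp
    finally show ?thesis .
  qed
  have "a \<bullet> a = (\<Sum>v\<in>B. u v * (a \<bullet> v))" by (subst (2) u) (simp add: inner_sum_right)
  then show ?thesis by (simp add: ab power2_eq_square)
qed

text \<open>In basis coordinates the functional is a combination of independent standard normals
  with coefficients \<open>a \<bullet> b\<close>.\<close>

lemma centered_normal_std_gaussian:
  assumes L: "subspace L" and a: "a \<in> L"
  shows "centered_normal (std_gaussian L) (\<lambda>x. a \<bullet> x) (a \<bullet> a)"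
proof -
  obtain B where fin: "finite B" and B: "orthonormal_basis_of L B"
    and eq: "std_gaussian L = distr (\<Pi>\<^sub>M b\<in>B. std_normal_distribution) borel (\<lambda>x. \<Sum>b\<in>B. x b *\<^sub>R b)" (is "_ = distr ?P _ ?s")
    by (rule std_gaussian_basis[OF L])
  note [measurable] = measurable_std_gaussian_sum
  have s: "a \<bullet> ?s x = (\<Sum>b\<in>B. x b * (a \<bullet> b))" for x by (simp add: inner_sum_right)
  have *: "centered_normal ?P (\<lambda>x. a \<bullet> ?s x) (a \<bullet> a)"
    using centered_normal_PiM_std_normal[OF fin, of "\<lambda>b. a \<bullet> b"]
    unfolding s orthonormal_basis_of_parseval[OF B fin a] .
  have d: "distr (distr ?P borel ?s) lborel (\<lambda>x. a \<bullet> x) = distr ?P lborel (\<lambda>x. a \<bullet> ?s x)"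
    by (subst distr_distr) (auto simp: comp_def)
  show ?thesis
  proof (cases "a \<bullet> a = 0")
    case True
    then show ?thesis by (simp add: centered_normal_def)
  next
    case False
    with * d show ?thesis unfolding eq by (simp add: centered_normal_def distributed_def)
  qed
qed

section \<open>Solid angles as Gaussian orthant probabilities\<close>

lemma std_gaussian_hyperplane_null:
  assumes L: "subspace L" and a: "a \<in> L" "a \<noteq> 0"
  shows "AE x in std_gaussian L. a \<bullet> x \<noteq> 0"
proof -
  have d: "distributed (std_gaussian L) lborel (\<lambda>x. a \<bullet> x) (\<lambda>t. ennreal (normal_density 0 (sqrt (a \<bullet> a)) t))"
    using centered_normal_std_gaussian[OF L a(1)] a(2) by (simp add: centered_normal_def)
  have "AE y in density lborel (\<lambda>t. ennreal (normal_density 0 (sqrt (a \<bullet> a)) t)). y \<noteq> 0"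
    using AE_lborel_singleton[of "0::real"] by (subst AE_density) auto
  then have "AE y in distr (std_gaussian L) lborel (\<lambda>x. a \<bullet> x). y \<noteq> 0"
    unfolding distributed_distr_eq_density[OF d] .
  then show ?thesis by (rule AE_distrD[rotated]) simp
qed

text \<open>The variance of a combination of the functionals \<open>u i \<bullet> x\<close> is the
  squared norm of the same combination of the \<open>u i\<close>, so their covariance matrix is the
  Gram matrix. For \<open>m = 0\<close> both sides are 1.\<close>

lemma gauss_orthant_eq_std_gaussian:
  fixes u :: "nat \<Rightarrow> 'a::euclidean_space"
  assumes L: "subspace L" and u: "\<And>i. i \<in> {1..m} \<Longrightarrow> u i \<in> L"
    and gram: "\<And>i j. i \<in> {1..m} \<Longrightarrow> j \<in> {1..m} \<Longrightarrow> u i \<bullet> u j = ortho_cov l0 l i j"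
  shows "gauss_orthant m l0 l eps = measure (std_gaussian L) {x. \<forall>i\<in>{1..m}. eps i * (u i \<bullet> x) < 0}"
proof (cases "m = 0")
  case True
  interpret G: prob_space "std_gaussian L" by (rule prob_space_std_gaussian[OF L])
  show ?thesis using True G.prob_space by (simp add: gauss_orthant_def)
next
  case False
  interpret G: prob_space "std_gaussian L" by (rule prob_space_std_gaussian[OF L])
  let ?P = "\<Pi>\<^sub>M i\<in>{1..m}. borel :: real measure"
  let ?f = "\<lambda>x. \<lambda>i\<in>{1..m}. u i \<bullet> x"
  have f[measurable]: "?f \<in> measurable (std_gaussian L) ?P" by measurable
  have m: "(\<lambda>x. \<Sum>i = 1..m. t i * x i) \<in> borel_measurable ?P" for t by measurable
  have cn: "centered_normal (distr (std_gaussian L) ?P ?f) (\<lambda>x. \<Sum>i=1..m. t i * x i)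
              (\<Sum>i=1..m. \<Sum>j=1..m. t i * t j * ortho_cov l0 l i j)" for t
  proof -
    let ?a = "\<Sum>i=1..m. t i *\<^sub>R u i"
    have v: "(\<Sum>i=1..m. \<Sum>j=1..m. t i * t j * ortho_cov l0 l i j) = ?a \<bullet> ?a"
      by (simp add: inner_sum_left) (simp add: inner_sum_right gram sum_distrib_left mult.assoc)
    have "?a \<in> L" using L u by (intro subspace_sum subspace_scale) auto
    from centered_normal_std_gaussian[OF L this]
    have *: "centered_normal (std_gaussian L) (\<lambda>x. \<Sum>i=1..m. t i * ?f x i) (?a \<bullet> ?a)"
      by (simp add: inner_sum_left)
    have d: "distr (distr (std_gaussian L) ?P ?f) lborel (\<lambda>x. \<Sum>i=1..m. t i * x i)
      = distr (std_gaussian L) lborel (\<lambda>x. \<Sum>i=1..m. t i * ?f x i)"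
      using m by (subst distr_distr) (auto simp: comp_def)
    show ?thesis unfolding v
    proof (cases "?a \<bullet> ?a = 0")
      case True
      have "(AE x in distr (std_gaussian L) ?P ?f. (\<Sum>i=1..m. t i * x i) = 0) \<longleftrightarrow>
        (AE x in std_gaussian L. (\<Sum>i=1..m. t i * ?f x i) = 0)"
        by (rule AE_distr_iff[OF f]) measurable
      with True * m show "centered_normal (distr (std_gaussian L) ?P ?f) (\<lambda>x. \<Sum>i=1..m. t i * x i) (?a \<bullet> ?a)"
        unfolding centered_normal_def by simp
    next
      case False
      with * d m show "centered_normal (distr (std_gaussian L) ?P ?f) (\<lambda>x. \<Sum>i=1..m. t i * x i) (?a \<bullet> ?a)"
        unfolding centered_normal_def distributed_def by simp
    qed
  qed
  have "gauss_orthant m l0 l eps = measure (distr (std_gaussian L) ?P ?f)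
    {x \<in> space (distr (std_gaussian L) ?P ?f). \<forall>i\<in>{1..m}. eps i * x i < 0}"
    by (rule gauss_orthant_eqI[OF False])
       (use cn G.prob_space_distr[OF f] in \<open>simp_all add: centered_gaussian_vector_def\<close>)
  also have "\<dots> = measure (std_gaussian L) (?f -` {x \<in> space ?P. \<forall>i\<in>{1..m}. eps i * x i < 0} \<inter> space (std_gaussian L))"
    by (subst measure_distr[OF f]) (simp_all, measurable)
  also have "?f -` {x \<in> space ?P. \<forall>i\<in>{1..m}. eps i * x i < 0} \<inter> space (std_gaussian L) = {x. \<forall>i\<in>{1..m}. eps i * (u i \<bullet> x) < 0}"
    by (auto simp: space_PiM)
  finally show ?thesis .
qed

text \<open>The bounding hyperplanes are null sets, each \<open>u i\<close> being a nonzero vector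
  of the linear hull; the closed halfspaces of the cone may therefore be replaced by the open ones
  of the orthant.\<close>

lemma gauss_orthant_eq_solid_angle:
  fixes u :: "nat \<Rightarrow> 'a::euclidean_space"
  assumes C: "C = {x \<in> span C. \<forall>i\<in>{1..m}. eps i * (u i \<bullet> x) \<le> 0}"
    and u: "\<And>i. i \<in> {1..m} \<Longrightarrow> u i \<in> span C" "\<And>i. i \<in> {1..m} \<Longrightarrow> u i \<noteq> 0"
    and eps: "\<And>i. i \<in> {1..m} \<Longrightarrow> eps i \<noteq> 0"
    and gram: "\<And>i j. i \<in> {1..m} \<Longrightarrow> j \<in> {1..m} \<Longrightarrow> u i \<bullet> u j = ortho_cov l0 l i j"
  shows "solid_angle C = gauss_orthant m l0 l eps"
proof -
  let ?L = "span C"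
  interpret G: prob_space "std_gaussian ?L" by (rule prob_space_std_gaussian) simp
  have L: "subspace ?L" by simp
  have [measurable]: "?L \<in> sets borel" using closed_subspace[OF L] by auto
  have "AE x in std_gaussian ?L. \<forall>i\<in>{1..m}. u i \<bullet> x \<noteq> 0"
    using u std_gaussian_hyperplane_null[OF L] by (auto simp: AE_finite_all)
  then have "AE x in std_gaussian ?L. (x \<in> {x. x \<in> ?L \<and> (\<forall>i\<in>{1..m}. eps i * (u i \<bullet> x) \<le> 0)}) = (x \<in> {x. \<forall>i\<in>{1..m}. eps i * (u i \<bullet> x) < 0})"
    using AE_std_gaussian[OF L]
  proof eventually_elim
    case (elim x)
    then show ?case using eps by (auto simp: less_le)
  qed
  moreover have "{x. x \<in> ?L \<and> (\<forall>i\<in>{1..m}. eps i * (u i \<bullet> x) \<le> 0)} \<in> sets borel"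
    "{x. \<forall>i\<in>{1..m}. eps i * (u i \<bullet> x) < 0} \<in> sets borel" by measurable
  ultimately have "measure (std_gaussian ?L) {x. x \<in> ?L \<and> (\<forall>i\<in>{1..m}. eps i * (u i \<bullet> x) \<le> 0)}
    = measure (std_gaussian ?L) {x. \<forall>i\<in>{1..m}. eps i * (u i \<bullet> x) < 0}"
    by (intro measure_eq_AE) auto
  then show ?thesis
    unfolding solid_angle_def using gauss_orthant_eq_std_gaussian[OF L u(1) gram, where eps = eps] C by simp
qed

section \<open>Direction spaces, biorthogonal systems and positive hulls\<close>

lemma direction_space_eq_span:
  assumes "c \<in> affine hull T"
  shows "direction_space T = span ((\<lambda>x. x - c) ` T)"
proof -
  \<comment> \<open>The base point \<open>c\<close> only has to lie in the affine hull; in the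
    applications it is a foot of perpendiculars or a relatively interior point and need not be a
    vertex.\<close>
  have "affine hull T = (+) c ` span ((\<lambda>x. x - c) ` T)"
    using affine_hull_span_gen[OF assms] by simp
  then have hull: "affine hull T = {c + v |v. v \<in> span ((\<lambda>x. x - c) ` T)}" by blast
  show ?thesis
  proof (intro equalityI subsetI)
    fix v assume "v \<in> direction_space T"
    then show "v \<in> span ((\<lambda>x. x - c) ` T)"
      by (auto simp: direction_space_def hull intro: span_diff)
  next
    fix v assume "v \<in> span ((\<lambda>x. x - c) ` T)"
    then have "c + v \<in> affine hull T" "c \<in> affine hull T" using hull span_zero by auto
    then show "v \<in> direction_space T"
      unfolding direction_space_def by (metis (mono_tags, lifting) add_diff_cancel_left' mem_Collect_eq)
  qed
qed

lemma direction_space_convex_hull [simp]: "direction_space (convex hull T) = direction_space T"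
  by (simp add: direction_space_def)

lemma diff_in_direction_space: "x \<in> affine hull T \<Longrightarrow> y \<in> affine hull T \<Longrightarrow> x - y \<in> direction_space T"
  by (auto simp: direction_space_def)

text \<open>Pairing a vanishing combination of the \<open>f i\<close> with one \<open>g i\<close>
  isolates a single coefficient.\<close>

lemma biorthogonal_independent:
  fixes f g :: "'i \<Rightarrow> 'a::real_inner"
  assumes I: "finite I" and orth: "\<And>i j. i \<in> I \<Longrightarrow> j \<in> I \<Longrightarrow> f i \<bullet> g j = 0 \<longleftrightarrow> i \<noteq> j"
  shows "inj_on f I" "independent (f ` I)"
proof -
  show inj: "inj_on f I" using orth by (intro inj_onI) metis
  show "independent (f ` I)"
  proof (rule independent_if_scalars_zero)
    fix u x assume sum: "(\<Sum>x\<in>f ` I. u x *\<^sub>R x) = 0" and "x \<in> f ` I"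
    then obtain i where i: "i \<in> I" "x = f i" by blast
    have "0 = (\<Sum>j\<in>I. u (f j) *\<^sub>R f j) \<bullet> g i" using sum by (simp add: sum.reindex[OF inj])
    also have "\<dots> = (\<Sum>j\<in>I. if j = i then u (f i) * (f i \<bullet> g i) else 0)"
      unfolding inner_sum_left using i orth by (intro sum.cong) auto
    also have "\<dots> = u (f i) * (f i \<bullet> g i)" using i I by simp
    finally show "u x = 0" using orth[of i i] i by simp
  qed (use I in simp)
qed

lemma sum_in_convex_cone_hull:
  assumes "\<And>i. i \<in> I \<Longrightarrow> 0 \<le> r i" "finite I"
  shows "(\<Sum>i\<in>I. r i *\<^sub>R f i) \<in> convex_cone hull (f ` I)"
  using assms(2,1)
proof (induction I rule: finite_induct)
  case empty
  then show ?case by simp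
next
  case (insert i I)
  have "convex_cone hull (f ` I) \<subseteq> convex_cone hull (f ` insert i I)" by (intro hull_mono) auto
  with insert show ?case
    by (auto intro!: convex_cone_hull_add convex_cone_hull_mul intro: hull_inc)
qed

lemma isometric_cones_refl: "isometric_cones C C"
  unfolding isometric_cones_def by (intro exI[of _ "\<lambda>x. x"]) (auto intro: linear_ident)

text \<open>Each step is a convex combination of the normalised sum so far and one new point. It
  serves to move from a point \<open>y\<close> of a face into the simplex by mixing in further
  vertices.\<close>

lemma convex_normalized_sum:
  fixes S :: "'a::real_vector set"
  assumes S: "convex S" "y \<in> S" and I: "finite I" and "\<And>i. i \<in> I \<Longrightarrow> a i \<in> S" "\<And>i. i \<in> I \<Longrightarrow> 0 \<le> r i"
  shows "(y + (\<Sum>i\<in>I. r i *\<^sub>R a i)) /\<^sub>R (1 + sum r I) \<in> S"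
  using I assms(4,5)
proof (induction I rule: finite_induct)
  case empty
  then show ?case using S by simp
next
  case (insert i I)
  let ?R = "sum r I" and ?w = "y + (\<Sum>i\<in>I. r i *\<^sub>R a i)"
  have R: "?R \<ge> 0" "r i \<ge> 0" using insert by (auto intro: sum_nonneg)
  then have pos: "1 + ?R + r i > 0" "1 + ?R > 0" by linarith+
  have IH: "?w /\<^sub>R (1 + ?R) \<in> S" using insert by simp
  have "((1 + ?R) / (1 + ?R + r i)) *\<^sub>R (?w /\<^sub>R (1 + ?R)) + (r i / (1 + ?R + r i)) *\<^sub>R a i \<in> S"
    using R pos insert.prems by (intro convexD[OF S(1) IH]) (auto simp: add_divide_distrib[symmetric])
  also have "((1 + ?R) / (1 + ?R + r i)) *\<^sub>R (?w /\<^sub>R (1 + ?R)) + (r i / (1 + ?R + r i)) *\<^sub>R a i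
      = (?w + r i *\<^sub>R a i) /\<^sub>R (1 + ?R + r i)"
  proof -
    have "(1 + ?R) / (1 + ?R + r i) * inverse (1 + ?R) = inverse (1 + ?R + r i)"
      using pos by (simp add: divide_inverse)
    then show ?thesis unfolding scaleR_scaleR by (simp only:) (simp add: scaleR_add_right divide_inverse mult.commute)
  qed
  finally show ?case using insert by (simp add: algebra_simps)
qed

text \<open>For biorthogonal \<open>n\<close> and \<open>z\<close> this map is the projection along
  the \<open>z j\<close>; linearity reduces its study to generators.\<close>

lemma linear_minus_sum:
  "linear (\<lambda>v. v - (\<Sum>j\<in>I. ((n j \<bullet> v) / d j) *\<^sub>R z j))"
  by (rule linearI)
     (simp_all add: inner_add_right add_divide_distrib scaleR_add_left sum.distrib
        scaleR_diff_right scaleR_sum_right)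

subsection \<open>A face of a simplex and its dual normals\<close>

text \<open>\<open>n j\<close> is an outward normal of the facet opposite the vertex \<open>a j\<close>, and \<open>c\<close> is the common foot of the
  perpendiculars from all \<open>a j\<close> to the affine hull of the face.\<close>

locale simplex_face =
  fixes K :: "'a::euclidean_space set" and I :: "nat set" and a n :: "nat \<Rightarrow> 'a" and c :: 'a
  assumes finite_I: "finite I" and affine_indep: "\<not> affine_dependent (K \<union> a ` I)"
    and c: "c \<in> affine hull K"
    and foot: "\<And>j b. j \<in> I \<Longrightarrow> b \<in> K \<Longrightarrow> (a j - c) \<bullet> (b - c) = 0"
    and n_dir: "\<And>j. j \<in> I \<Longrightarrow> n j \<in> direction_space (K \<union> a ` I)"
    and n_K: "\<And>j b. j \<in> I \<Longrightarrow> b \<in> K \<Longrightarrow> n j \<bullet> (b - c) = 0"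
    and n_other: "\<And>i j. i \<in> I \<Longrightarrow> j \<in> I \<Longrightarrow> i \<noteq> j \<Longrightarrow> n j \<bullet> (a i - c) = 0"
    and n_neg: "\<And>j. j \<in> I \<Longrightarrow> n j \<bullet> (a j - c) < 0"
begin

abbreviation "T \<equiv> K \<union> a ` I"
abbreviation "V \<equiv> direction_space T"
abbreviation "L \<equiv> direction_space K"
abbreviation "z j \<equiv> a j - c"

lemma c_T: "c \<in> affine hull T"
  using c hull_mono[of K T affine] by auto

lemma V_eq: "V = span ((\<lambda>x. x - c) ` T)" by (rule direction_space_eq_span[OF c_T])
lemma L_eq: "L = span ((\<lambda>x. x - c) ` K)" by (rule direction_space_eq_span[OF c])
lemma subspace_V [simp]: "subspace V" by (simp add: V_eq)
lemma subspace_L [simp]: "subspace L" by (simp add: L_eq)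
lemma L_subset_V: "L \<subseteq> V" unfolding L_eq V_eq by (intro span_mono) auto
lemma z_V: "j \<in> I \<Longrightarrow> z j \<in> V" unfolding V_eq by (intro span_base) auto

lemma orthogonal_L:
  assumes "\<And>b. b \<in> K \<Longrightarrow> v \<bullet> (b - c) = 0" and "l \<in> L"
  shows "v \<bullet> l = 0"
  using assms(2) unfolding L_eq
  by (induction rule: span_induct) (use assms(1) in \<open>auto intro!: subspace_hyperplane\<close>)

lemma z_L: "j \<in> I \<Longrightarrow> l \<in> L \<Longrightarrow> z j \<bullet> l = 0"
  by (rule orthogonal_L) (rule foot)

lemma n_L: "j \<in> I \<Longrightarrow> l \<in> L \<Longrightarrow> n j \<bullet> l = 0"
  by (rule orthogonal_L) (rule n_K)

lemma n_z: "i \<in> I \<Longrightarrow> j \<in> I \<Longrightarrow> n j \<bullet> z i = 0 \<longleftrightarrow> i \<noteq> j"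
  using n_other n_neg by force

text \<open>The map \<open>g\<close> is linear, fixes the generators \<open>b - c\<close> of
  \<open>L\<close> and sends every \<open>z i\<close> to 0: it is the orthogonal projection of
  \<open>V\<close> onto \<open>L\<close>.\<close>

lemma vector_split:
  assumes "v \<in> V"
  shows "v - (\<Sum>j\<in>I. (n j \<bullet> v / (n j \<bullet> z j)) *\<^sub>R z j) \<in> L"
proof -
  define g where "g v = v - (\<Sum>j\<in>I. (n j \<bullet> v / (n j \<bullet> z j)) *\<^sub>R z j)" for v
  have lin: "linear g"
    unfolding g_def by (rule linear_minus_sum)
  have gen: "g x \<in> L" if x: "x \<in> (\<lambda>x. x - c) ` T" for x
  proof -
    consider b where "b \<in> K" "x = b - c" | i where "i \<in> I" "x = z i" using x by auto
    then show ?thesis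
    proof cases
      case 1
      then have "g x = x" by (simp add: g_def n_K)
      with 1 show ?thesis by (simp add: L_eq span_base)
    next
      case 2
      have "(\<Sum>j\<in>I. (n j \<bullet> x / (n j \<bullet> z j)) *\<^sub>R z j) = (\<Sum>j\<in>I. if j = i then z i else 0)"
        using 2 n_neg[of i] n_other by (intro sum.cong) auto
      with 2 finite_I have "g x = 0" by (simp add: g_def)
      then show ?thesis by (simp add: L_eq span_zero)
    qed
  qed
  have "g v \<in> L" using assms unfolding V_eq
  proof (induction rule: span_induct_alt)
    case base
    then show ?case using linear_0[OF lin] by (simp add: L_eq span_zero)
  next
    case (step r x y)
    then show ?case using gen
      by (auto simp: linear_add[OF lin] linear_scale[OF lin] intro!: subspace_add subspace_scale)
  qed
  then show ?thesis by (simp add: g_def)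
qed

text \<open>The orthogonal complement of \<open>L\<close> within \<open>V\<close>; by
  \<open>span_normal_cone\<close> it is the linear hull of the normal cone, on which the external
  angle is taken.\<close>

definition "W = {v \<in> V. \<forall>l\<in>L. v \<bullet> l = 0}"

lemma subspace_W [simp]: "subspace W"
  unfolding W_def by (rule subspaceI) (auto simp: inner_add_left intro: subspace_0 subspace_add subspace_scale)

lemma z_W: "j \<in> I \<Longrightarrow> z j \<in> W" using z_V z_L by (simp add: W_def)
lemma n_W: "j \<in> I \<Longrightarrow> n j \<in> W" using n_dir n_L by (simp add: W_def)

text \<open>The remainder \<open>r\<close> lies in \<open>V\<close> and is orthogonal to
  \<open>L\<close> and, by biorthogonality, to every \<open>z i\<close>; hence it is orthogonal to
  all of \<open>V\<close> and so to itself.\<close>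

lemma normal_expansion:
  assumes "v \<in> W"
  shows "v = (\<Sum>j\<in>I. (v \<bullet> z j / (n j \<bullet> z j)) *\<^sub>R n j)"
proof -
  define r where "r = v - (\<Sum>j\<in>I. (v \<bullet> z j / (n j \<bullet> z j)) *\<^sub>R n j)"
  have rW: "r \<in> W" unfolding r_def using assms n_W
    by (intro subspace_diff subspace_sum subspace_scale) auto
  have rx: "r \<bullet> x = 0" if x: "x \<in> (\<lambda>x. x - c) ` T" for x
  proof -
    consider b where "b \<in> K" "x = b - c" | i where "i \<in> I" "x = z i" using x by auto
    then show ?thesis
    proof cases
      case 1
      then have "x \<in> L" by (simp add: L_eq span_base)
      with rW show ?thesis by (simp add: W_def)
    next
      case 2
      have "(\<Sum>j\<in>I. (v \<bullet> z j / (n j \<bullet> z j)) *\<^sub>R n j) \<bullet> x = (\<Sum>j\<in>I. if j = i then v \<bullet> z i else 0)"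
        unfolding inner_sum_left using 2 n_neg[of i] n_other by (intro sum.cong) auto
      with 2 finite_I show ?thesis by (simp add: r_def inner_diff_left)
    qed
  qed
  have "r \<bullet> x = 0" if "x \<in> V" for x
    using that unfolding V_eq by (induction rule: span_induct) (use rx in \<open>auto intro!: subspace_hyperplane\<close>)
  moreover have "r \<in> V" using rW by (simp add: W_def)
  ultimately have "r = 0" by (metis inner_eq_zero_iff)
  then show ?thesis by (simp add: r_def)
qed

section \<open>Tangent and normal cones at the face\<close>

lemma face: "convex hull K face_of convex hull T"
  using face_of_convex_hull_affine_independent[OF affine_indep] by blast

lemma K_nonempty: "K \<noteq> {}" using c by auto

lemma rel_interior_K:
  obtains x0 where "x0 \<in> rel_interior (convex hull K)"
  using K_nonempty by (metis convex_convex_hull convex_hull_eq_empty ex_in_conv rel_interior_eq_empty)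

text \<open>The simplex lies in each halfspace given by \<open>n j\<close> with the face on its
  boundary, which yields one inclusion. Conversely, \<open>vector_split\<close> gives
  \<open>v\<close> nonnegative coefficients on the \<open>z j\<close>; a short step from
  \<open>x0\<close> inside the face, followed by mixing in the vertices \<open>a j\<close>, realises
  a positive multiple of \<open>v\<close>.\<close>

lemma tangent_cone_halfspaces:
  "tangent_cone V (convex hull K) (convex hull T) = {v \<in> V. \<forall>j\<in>I. n j \<bullet> v \<le> 0}"
proof -
  obtain x0 where x0: "x0 \<in> rel_interior (convex hull K)" by (rule rel_interior_K)
  then have x0F: "x0 \<in> convex hull K" using rel_interior_subset by blast
  then have x0K: "x0 \<in> affine hull K" using convex_hull_subset_affine_hull by blast
  note eq = tangent_cone_eq[OF convex_convex_hull face x0, of V]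
  have "(\<exists>\<epsilon>>0. x0 + \<epsilon> *\<^sub>R v \<in> convex hull T) \<longleftrightarrow> (\<forall>j\<in>I. n j \<bullet> v \<le> 0)" if v: "v \<in> V" for v
  proof
    assume "\<exists>\<epsilon>>0. x0 + \<epsilon> *\<^sub>R v \<in> convex hull T"
    then obtain \<epsilon> where e: "\<epsilon> > 0" "x0 + \<epsilon> *\<^sub>R v \<in> convex hull T" by blast
    show "\<forall>j\<in>I. n j \<bullet> v \<le> 0"
    proof
      fix j assume j: "j \<in> I"
      have "convex hull T \<subseteq> {y. n j \<bullet> y \<le> n j \<bullet> c}"
      proof (rule hull_minimal)
        show "T \<subseteq> {y. n j \<bullet> y \<le> n j \<bullet> c}"
          using n_K[OF j] n_other[OF _ j] n_neg[OF j] by (force simp: inner_diff_right)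
      qed (rule convex_halfspace_le)
      with e have "n j \<bullet> x0 + \<epsilon> * (n j \<bullet> v) \<le> n j \<bullet> c" by (auto simp: inner_add_right)
      moreover have "n j \<bullet> (x0 - c) = 0" using n_L[OF j] diff_in_direction_space[OF x0K c] by blast
      ultimately show "n j \<bullet> v \<le> 0" using e by (simp add: inner_diff_right mult_le_0_iff)
    qed
  next
    assume neg: "\<forall>j\<in>I. n j \<bullet> v \<le> 0"
    define r where "r j = n j \<bullet> v / (n j \<bullet> z j)" for j
    define R where "R = (\<Sum>j\<in>I. r j)"
    define l where "l = v - (\<Sum>j\<in>I. r j *\<^sub>R z j)"
    have l: "l \<in> L" using vector_split[OF v] by (simp add: l_def r_def)
    have r: "r j \<ge> 0" if "j \<in> I" for j
      using neg n_neg[OF that] that by (auto simp: r_def intro: divide_nonpos_neg)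
    then have R: "R \<ge> 0" by (auto simp: R_def intro: sum_nonneg)
    \<comment> \<open>Passing from \<open>z j = a j - c\<close> to \<open>a j - x0\<close> costs
      \<open>R *\<^sub>R (x0 - c)\<close>: with this correction, \<open>v\<close> is
      \<open>l'\<close> plus the vectors \<open>a j - x0\<close> weighted by
      \<open>r j\<close>.\<close>
    define l' where "l' = l + R *\<^sub>R (x0 - c)"
    have l': "l' \<in> L"
      unfolding l'_def using l diff_in_direction_space[OF x0K c] by (intro subspace_add subspace_scale) auto
    obtain e where e: "e > 0" "ball x0 e \<inter> affine hull (convex hull K) \<subseteq> convex hull K"
      using x0 by (auto simp: mem_rel_interior_ball)
    \<comment> \<open>Chosen so that \<open>x0 + \<delta> *\<^sub>R l'\<close> stays in the ball of
      radius \<open>e\<close>; the summand 1 covers the case \<open>l' = 0\<close>.\<close>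
    define \<delta> where "\<delta> = e / (2 * (norm l' + 1))"
    have \<delta>: "\<delta> > 0" using e by (simp add: \<delta>_def add_nonneg_pos)
    have "x0 + \<delta> *\<^sub>R l' \<in> affine hull K"
    proof -
      obtain y y' where y: "l' = y - y'" "y \<in> affine hull K" "y' \<in> affine hull K"
        using l' by (auto simp: direction_space_def)
      show ?thesis unfolding y(1) by (rule mem_affine_3_minus[OF affine_affine_hull x0K y(2,3)])
    qed
    moreover have "norm (\<delta> *\<^sub>R l') < e"
    proof -
      have "norm (\<delta> *\<^sub>R l') = (e / 2) * (norm l' / (norm l' + 1))" using e by (simp add: \<delta>_def)
      also have "\<dots> \<le> (e / 2) * 1" using e by (intro mult_left_mono) (auto simp: divide_le_eq_1 add_nonneg_pos)
      finally show ?thesis using e by simp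
    qed
    ultimately have y: "x0 + \<delta> *\<^sub>R l' \<in> convex hull T"
    proof -
      have "x0 + \<delta> *\<^sub>R l' \<in> ball x0 e" using \<open>norm (\<delta> *\<^sub>R l') < e\<close> by (simp add: dist_norm)
      then have "x0 + \<delta> *\<^sub>R l' \<in> convex hull K" using e(2) \<open>x0 + \<delta> *\<^sub>R l' \<in> affine hull K\<close> by auto
      then show ?thesis using hull_mono[of K T convex] by blast
    qed
    have pos: "1 + \<delta> * R > 0" using \<delta> R by (simp add: add_pos_nonneg)
    \<comment> \<open>The vertices enter with weights \<open>\<delta> * r j\<close>; division by the
      total weight leaves \<open>x0\<close> plus the multiple
      \<open>\<delta> / (1 + \<delta> * R)\<close> of \<open>v\<close>.\<close>
    have "(x0 + \<delta> *\<^sub>R l' + (\<Sum>j\<in>I. (\<delta> * r j) *\<^sub>R a j)) /\<^sub>R (1 + (\<Sum>j\<in>I. \<delta> * r j)) \<in> convex hull T"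
      using r \<delta> y by (intro convex_normalized_sum finite_I) (auto intro: hull_inc)
    also have "(x0 + \<delta> *\<^sub>R l' + (\<Sum>j\<in>I. (\<delta> * r j) *\<^sub>R a j)) /\<^sub>R (1 + (\<Sum>j\<in>I. \<delta> * r j)) = x0 + (\<delta> / (1 + \<delta> * R)) *\<^sub>R v"
    proof -
      have v: "v = l' - R *\<^sub>R x0 + (\<Sum>j\<in>I. r j *\<^sub>R a j)"
        by (simp add: l'_def l_def R_def algebra_simps sum_subtractf scaleR_sum_left)
      have "(\<Sum>j\<in>I. (\<delta> * r j) *\<^sub>R a j) = \<delta> *\<^sub>R (\<Sum>j\<in>I. r j *\<^sub>R a j)" "(\<Sum>j\<in>I. \<delta> * r j) = \<delta> * R"
        by (simp_all add: R_def scaleR_sum_right sum_distrib_left)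
      then have "(x0 + \<delta> *\<^sub>R l' + (\<Sum>j\<in>I. (\<delta> * r j) *\<^sub>R a j)) /\<^sub>R (1 + (\<Sum>j\<in>I. \<delta> * r j)) =
          ((1 + \<delta> * R) *\<^sub>R x0 + \<delta> *\<^sub>R v) /\<^sub>R (1 + \<delta> * R)"
        unfolding v by (simp add: algebra_simps)
      also have "\<dots> = x0 + (\<delta> / (1 + \<delta> * R)) *\<^sub>R v"
        using pos by (subst scaleR_add_right) (simp add: divide_inverse mult.commute)
      finally show ?thesis .
    qed
    finally show "\<exists>\<epsilon>>0. x0 + \<epsilon> *\<^sub>R v \<in> convex hull T" using \<delta> pos by (intro exI[of _ "\<delta> / (1 + \<delta> * R)"]) auto
  qed
  then show ?thesis unfolding eq by blast
qed

text \<open>The coefficients in \<open>vector_split\<close> have the negative denominators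
  \<open>n j \<bullet> z j\<close>, so they are nonnegative when every
  \<open>n j \<bullet> v\<close> is nonpositive.\<close>

lemma tangent_cone_decomposition:
  "tangent_cone V (convex hull K) (convex hull T) = {x + y | x y. x \<in> L \<and> y \<in> convex_cone hull (z ` I)}"
  unfolding tangent_cone_halfspaces
proof (intro equalityI subsetI)
  fix v assume "v \<in> {v \<in> V. \<forall>j\<in>I. n j \<bullet> v \<le> 0}"
  then have v: "v \<in> V" "\<And>j. j \<in> I \<Longrightarrow> n j \<bullet> v \<le> 0" by auto
  let ?y = "\<Sum>j\<in>I. (n j \<bullet> v / (n j \<bullet> z j)) *\<^sub>R z j"
  have "?y \<in> convex_cone hull (z ` I)"
    using v(2) n_neg by (intro sum_in_convex_cone_hull finite_I) (auto intro!: divide_nonpos_neg)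
  with vector_split[OF v(1)] show "v \<in> {x + y | x y. x \<in> L \<and> y \<in> convex_cone hull (z ` I)}"
    by (intro CollectI exI[of _ "v - ?y"] exI[of _ ?y]) simp
next
  fix v assume "v \<in> {x + y | x y. x \<in> L \<and> y \<in> convex_cone hull (z ` I)}"
  then obtain x y where v: "v = x + y" and x: "x \<in> L" and y: "y \<in> convex_cone hull (z ` I)" by blast
  have "convex_cone {v \<in> V. \<forall>j\<in>I. n j \<bullet> v \<le> 0}"
    unfolding convex_cone_iff
    by (auto simp: inner_add_right intro: subspace_0 subspace_add subspace_scale add_nonpos_nonpos mult_nonneg_nonpos)
  moreover have "z ` I \<subseteq> {v \<in> V. \<forall>j\<in>I. n j \<bullet> v \<le> 0}"
  proof clarify
    fix i assume i: "i \<in> I"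
    have "n j \<bullet> z i \<le> 0" if "j \<in> I" for j
      using n_other[OF i that] n_neg[OF i] by (cases "i = j") auto
    with z_V[OF i] show "z i \<in> V \<and> (\<forall>j\<in>I. n j \<bullet> z i \<le> 0)" by blast
  qed
  ultimately have "convex_cone hull (z ` I) \<subseteq> {v \<in> V. \<forall>j\<in>I. n j \<bullet> v \<le> 0}" by (intro hull_minimal)
  with x y show "v \<in> {v \<in> V. \<forall>j\<in>I. n j \<bullet> v \<le> 0}"
    using L_subset_V n_L by (auto simp: v inner_add_right intro: subspace_add)
qed

lemma orthogonal_L_cone:
  assumes "x \<in> L" "y \<in> convex_cone hull (z ` I)"
  shows "orthogonal x y"
proof -
  have "convex_cone hull (z ` I) \<subseteq> W"
    by (rule hull_minimal) (use z_W in \<open>auto intro: subspace_imp_convex_cone\<close>)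
  with assms show ?thesis by (auto simp: W_def orthogonal_def inner_commute)
qed

text \<open>The cone contains \<open>L\<close> and every \<open>z j\<close>, which together span
  \<open>V\<close>; the internal angle is thus taken with the Gaussian law on
  \<open>V\<close>.\<close>

lemma span_tangent_cone: "span (tangent_cone V (convex hull K) (convex hull T)) = V"
proof
  let ?C = "tangent_cone V (convex hull K) (convex hull T)"
  show "span ?C \<subseteq> V" by (rule span_minimal) (auto simp: tangent_cone_def)
  have LC: "L \<subseteq> ?C" unfolding tangent_cone_halfspaces using L_subset_V n_L by auto
  have zC: "z j \<in> ?C" if "j \<in> I" for j
    unfolding tangent_cone_decomposition using that
    by (intro CollectI exI[of _ 0] exI[of _ "z j"]) (auto simp: subspace_0 intro: hull_inc)
  show "V \<subseteq> span ?C"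
  proof
    fix v assume v: "v \<in> V"
    let ?y = "\<Sum>j\<in>I. (n j \<bullet> v / (n j \<bullet> z j)) *\<^sub>R z j"
    have "v - ?y \<in> span ?C" using vector_split[OF v] LC span_superset by blast
    moreover have "?y \<in> span ?C" using zC by (intro span_sum span_scale) (auto intro: span_base)
    ultimately have "(v - ?y) + ?y \<in> span ?C" by (rule span_add)
    then show "v \<in> span ?C" by simp
  qed
qed

text \<open>Since \<open>x0\<close> is relatively interior, a normal vector is orthogonal to
  \<open>L\<close>; the base point may then be moved from \<open>x0\<close> to \<open>c\<close>, and
  only the inequalities at the vertices \<open>a j\<close> remain.\<close>

lemma normal_cone_halfspaces:
  "normal_cone V (convex hull K) (convex hull T) = {v \<in> W. \<forall>j\<in>I. z j \<bullet> v \<le> 0}"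
proof -
  obtain x0 where x0: "x0 \<in> rel_interior (convex hull K)" by (rule rel_interior_K)
  then have x0F: "x0 \<in> convex hull K" using rel_interior_subset by blast
  then have x0K: "x0 \<in> affine hull K" using convex_hull_subset_affine_hull by blast
  have x0c: "x0 - c \<in> L" by (rule diff_in_direction_space[OF x0K c])
  note eq = normal_cone_eq[OF face x0, of V]
  show ?thesis unfolding eq
  proof (intro equalityI subsetI)
    fix v assume "v \<in> {v \<in> V. \<forall>y\<in>convex hull T. v \<bullet> (y - x0) \<le> 0}"
    then have v: "v \<in> V" "\<And>y. y \<in> convex hull T \<Longrightarrow> v \<bullet> (y - x0) \<le> 0" by auto
    have sub: "convex hull K \<subseteq> convex hull T" by (intro hull_mono) auto
    have K: "v \<bullet> (b - x0) = 0" if "b \<in> K" for b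
    proof -
      have b: "b \<in> convex hull K" using that by (rule hull_inc)
      \<comment> \<open>The segment from \<open>b\<close> can be prolonged beyond \<open>x0\<close>
        within the face, so the inequality holds in both directions.\<close>
      obtain \<delta> where "\<delta> > 0" "x0 + \<delta> *\<^sub>R (x0 - b) \<in> convex hull K"
        using rel_interior_extend[OF convex_convex_hull x0 b] by blast
      then have "v \<bullet> (x0 + \<delta> *\<^sub>R (x0 - b) - x0) \<le> 0" using sub v(2) by blast
      then have "v \<bullet> (x0 - b) \<le> 0" using \<open>\<delta> > 0\<close> by (simp add: mult_le_0_iff)
      moreover have "v \<bullet> (b - x0) \<le> 0" using b sub v(2) by blast
      ultimately show ?thesis by (simp add: inner_diff_right)
    qed
    have L: "v \<bullet> l = 0" if "l \<in> L" for l
      using that unfolding direction_space_eq_span[OF x0K]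
      by (induction rule: span_induct) (use K in \<open>auto intro!: subspace_hyperplane\<close>)
    have "z j \<bullet> v \<le> 0" if "j \<in> I" for j
    proof -
      have "v \<bullet> (a j - x0) \<le> 0" using that by (intro v(2) hull_inc) auto
      with L[OF x0c] show ?thesis by (simp add: inner_diff_right inner_commute[of _ v])
    qed
    with v(1) L show "v \<in> {v \<in> W. \<forall>j\<in>I. z j \<bullet> v \<le> 0}" by (simp add: W_def)
  next
    fix v assume "v \<in> {v \<in> W. \<forall>j\<in>I. z j \<bullet> v \<le> 0}"
    then have v: "v \<in> V" "\<And>l. l \<in> L \<Longrightarrow> v \<bullet> l = 0" "\<And>j. j \<in> I \<Longrightarrow> z j \<bullet> v \<le> 0" by (auto simp: W_def)
    have "convex hull T \<subseteq> {y. v \<bullet> y \<le> v \<bullet> c}"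
    proof (rule hull_minimal)
      have "v \<bullet> (b - c) = 0" if "b \<in> K" for b using that by (intro v(2)) (simp add: L_eq span_base)
      then show "T \<subseteq> {y. v \<bullet> y \<le> v \<bullet> c}"
        using v(3) by (force simp: inner_diff_right inner_diff_left inner_commute[of _ v])
    qed (rule convex_halfspace_le)
    with v(1) v(2)[OF x0c] show "v \<in> {v \<in> V. \<forall>y\<in>convex hull T. v \<bullet> (y - x0) \<le> 0}"
      by (auto simp: inner_diff_right)
  qed
qed

text \<open>Dual to \<open>tangent_cone_decomposition\<close>: \<open>normal_expansion\<close> takes
  the place of \<open>vector_split\<close>, with the roles of \<open>n j\<close> and
  \<open>z j\<close> exchanged.\<close>

lemma normal_cone_eq_hull:
  "normal_cone V (convex hull K) (convex hull T) = convex_cone hull (n ` I)"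
  unfolding normal_cone_halfspaces
proof (intro equalityI subsetI)
  fix v assume "v \<in> {v \<in> W. \<forall>j\<in>I. z j \<bullet> v \<le> 0}"
  then have v: "v \<in> W" "\<And>j. j \<in> I \<Longrightarrow> v \<bullet> z j \<le> 0" by (auto simp: inner_commute)
  have "(\<Sum>j\<in>I. (v \<bullet> z j / (n j \<bullet> z j)) *\<^sub>R n j) \<in> convex_cone hull (n ` I)"
    using v(2) n_neg by (intro sum_in_convex_cone_hull finite_I) (auto intro!: divide_nonpos_neg)
  then show "v \<in> convex_cone hull (n ` I)" using normal_expansion[OF v(1)] by simp
next
  have "convex_cone {v \<in> W. \<forall>j\<in>I. z j \<bullet> v \<le> 0}"
    unfolding convex_cone_iff
    by (auto simp: inner_add_right intro: subspace_0 subspace_add subspace_scale add_nonpos_nonpos mult_nonneg_nonpos)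
  moreover have "n ` I \<subseteq> {v \<in> W. \<forall>j\<in>I. z j \<bullet> v \<le> 0}"
  proof clarify
    fix i assume i: "i \<in> I"
    have "z j \<bullet> n i \<le> 0" if "j \<in> I" for j
      using n_other[OF that i] n_neg[OF i] by (cases "i = j") (auto simp: inner_commute)
    with n_W[OF i] show "n i \<in> W \<and> (\<forall>j\<in>I. z j \<bullet> n i \<le> 0)" by blast
  qed
  ultimately have "convex_cone hull (n ` I) \<subseteq> {v \<in> W. \<forall>j\<in>I. z j \<bullet> v \<le> 0}" by (intro hull_minimal)
  then show "v \<in> {v \<in> W. \<forall>j\<in>I. z j \<bullet> v \<le> 0}" if "v \<in> convex_cone hull (n ` I)" for v
    using that by blast
qed

lemma span_normal_cone: "span (normal_cone V (convex hull K) (convex hull T)) = W"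
proof
  show "span (normal_cone V (convex hull K) (convex hull T)) \<subseteq> W"
    by (rule span_minimal) (auto simp: normal_cone_halfspaces)
  show "W \<subseteq> span (normal_cone V (convex hull K) (convex hull T))"
  proof
    fix v assume "v \<in> W"
    moreover have "n j \<in> normal_cone V (convex hull K) (convex hull T)" if "j \<in> I" for j
      unfolding normal_cone_eq_hull using that by (auto intro: hull_inc)
    ultimately show "v \<in> span (normal_cone V (convex hull K) (convex hull T))"
      by (subst normal_expansion) (auto intro!: span_sum span_scale intro: span_base)
  qed
qed

section \<open>Orthocentric cones and angles at the face from Gram matrices\<close>

lemma tangent_cone_orthocentric:
  assumes I: "I = {1..m}" "1 \<le> m" and cond: "cond_A m l0 l \<or> cond_B m l0 l"
    and gram: "\<And>i j. i \<in> I \<Longrightarrow> j \<in> I \<Longrightarrow> z i \<bullet> z j = ortho_cov l0 l i j"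
  shows "\<exists>C. tangent_cone V (convex hull K) (convex hull T) = {x + y | x y. x \<in> L \<and> y \<in> C} \<and>
           (\<forall>x\<in>L. \<forall>y\<in>C. orthogonal x y) \<and>
           isometric_to_orthocentric_cone C m l0 l (\<lambda>i. 1)"
proof (intro exI conjI ballI)
  show "tangent_cone V (convex hull K) (convex hull T) =
      {x + y | x y. x \<in> L \<and> y \<in> convex_cone hull (z ` I)}"
    by (rule tangent_cone_decomposition)
  have "inj_on z I" "independent (z ` I)"
    using biorthogonal_independent[OF finite_I, of z n] n_z by (auto simp: inner_commute)
  then have "orthocentric_cone m l0 l (\<lambda>i. 1) (convex_cone hull (z ` I))"
    unfolding orthocentric_cone_def I(1)[symmetric] using I cond gram by (intro conjI exI[of _ z]) auto
  then show "isometric_to_orthocentric_cone (convex_cone hull (z ` I)) m l0 l (\<lambda>i. 1)"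
    unfolding isometric_to_orthocentric_cone_def using isometric_cones_refl by blast
qed (rule orthogonal_L_cone)

text \<open>The vectors of the realisation are \<open>eps j *\<^sub>R n j\<close>; the definition of
  the cone applies the signs a second time and so returns the normals \<open>n j\<close>.\<close>

lemma normal_cone_orthocentric:
  assumes I: "I = {1..m}" "1 \<le> m" and cond: "cond_A m l0 l \<or> cond_B m l0 l"
    and eps: "\<And>i. i \<in> I \<Longrightarrow> eps i = 1 \<or> eps i = -1"
    and gram: "\<And>i j. i \<in> I \<Longrightarrow> j \<in> I \<Longrightarrow> eps i * eps j * (n i \<bullet> n j) = ortho_cov l0 l i j"
  shows "isometric_to_orthocentric_cone (normal_cone V (convex hull K) (convex hull T)) m l0 l eps"
proof -
  let ?u = "\<lambda>j. eps j *\<^sub>R n j"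
  have "inj_on ?u I" "independent (?u ` I)"
    using biorthogonal_independent[OF finite_I, of ?u z] n_z eps by fastforce+
  moreover have "(\<lambda>j. eps j *\<^sub>R ?u j) ` I = n ` I"
    using eps by (intro image_cong) fastforce+
  moreover have "?u i \<bullet> ?u j = ortho_cov l0 l i j" if "i \<in> I" "j \<in> I" for i j
    using gram[OF that] by (simp add: ac_simps)
  ultimately have "orthocentric_cone m l0 l eps (normal_cone V (convex hull K) (convex hull T))"
    unfolding orthocentric_cone_def I(1)[symmetric] normal_cone_eq_hull
    using I cond gram eps by (intro conjI exI[of _ ?u]) (auto simp: mult.assoc)
  then show ?thesis
    unfolding isometric_to_orthocentric_cone_def using isometric_cones_refl by blast
qed

text \<open>The tangent cone is cut out by the normals, so the internal angle is governed by the
  Gram matrix of the generators of the normal cone, signs included.\<close>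

lemma internal_angle_eq_gauss_orthant:
  assumes I: "I = {1..m}"
    and eps: "\<And>i. i \<in> I \<Longrightarrow> eps i = 1 \<or> eps i = -1"
    and gram: "\<And>i j. i \<in> I \<Longrightarrow> j \<in> I \<Longrightarrow> eps i * eps j * (n i \<bullet> n j) = ortho_cov l0 l i j"
  shows "internal_angle V (convex hull K) (convex hull T) = gauss_orthant m l0 l eps"
  unfolding internal_angle_def
proof (rule gauss_orthant_eq_solid_angle[where u = "\<lambda>j. eps j *\<^sub>R n j"]; unfold span_tangent_cone I[symmetric])
  have "eps i * (eps i * r) = r" if "i \<in> I" for i r using eps[OF that] by auto
  then have "(\<forall>i\<in>I. eps i * ((eps i *\<^sub>R n i) \<bullet> x) \<le> 0) \<longleftrightarrow> (\<forall>i\<in>I. n i \<bullet> x \<le> 0)" for x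
    by (intro ball_cong refl) (simp only: inner_scaleR_left)
  then show "tangent_cone V (convex hull K) (convex hull T) = {x \<in> V. \<forall>i\<in>I. eps i * ((eps i *\<^sub>R n i) \<bullet> x) \<le> 0}"
    unfolding tangent_cone_halfspaces by blast
  show "eps i *\<^sub>R n i \<in> V" if "i \<in> I" for i using n_dir[OF that] by (intro subspace_scale) auto
  show "eps i *\<^sub>R n i \<noteq> 0" if "i \<in> I" for i using eps[OF that] n_neg[OF that] by auto
  show "eps i \<noteq> 0" if "i \<in> I" for i using eps[OF that] by auto
  show "(eps i *\<^sub>R n i) \<bullet> (eps j *\<^sub>R n j) = ortho_cov l0 l i j" if "i \<in> I" "j \<in> I" for i j
    using gram[OF that] by (simp add: ac_simps)
qed

text \<open>Dually, the normal cone is cut out within \<open>W\<close> by the \<open>z j\<close>, so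
  their Gram matrix governs the external angle.\<close>

lemma external_angle_eq_gauss_orthant:
  assumes I: "I = {1..m}"
    and gram: "\<And>i j. i \<in> I \<Longrightarrow> j \<in> I \<Longrightarrow> z i \<bullet> z j = ortho_cov l0 l i j"
  shows "external_angle V (convex hull K) (convex hull T) = gauss_orthant m l0 l (\<lambda>i. 1)"
  unfolding external_angle_def
proof (rule gauss_orthant_eq_solid_angle[where u = z]; unfold span_normal_cone I[symmetric])
  show "normal_cone V (convex hull K) (convex hull T) = {x \<in> W. \<forall>i\<in>I. 1 * (z i \<bullet> x) \<le> 0}"
    unfolding normal_cone_halfspaces by simp
  show "z i \<in> W" if "i \<in> I" for i by (rule z_W[OF that])
  show "z i \<noteq> 0" if "i \<in> I" for i using n_neg[OF that] by auto
qed (use gram in auto)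

end

section \<open>Affine combinations and sums over index ranges\<close>

lemma affine_hull_add_sum:
  fixes x :: "'a::euclidean_space"
  assumes x: "x \<in> affine hull T" and y: "\<And>i. i \<in> I \<Longrightarrow> y i \<in> affine hull T"
  shows "x + (\<Sum>i\<in>I. u i *\<^sub>R (y i - x)) \<in> affine hull T"
proof -
  have "(\<Sum>i\<in>I. u i *\<^sub>R (y i - x)) \<in> direction_space T"
    using diff_in_direction_space[OF y x] unfolding direction_space_eq_span[OF x]
    by (intro span_sum span_scale) auto
  then obtain a b where ab: "a \<in> affine hull T" "b \<in> affine hull T" "(\<Sum>i\<in>I. u i *\<^sub>R (y i - x)) = a - b"
    by (auto simp: direction_space_def)
  show ?thesis
    using mem_affine_3_minus[OF affine_affine_hull x ab(1,2), of 1] by (simp add: ab(3))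
qed

lemma sum_upd_zero: "(\<Sum>i\<le>m. (l(0 := l0)) i) = l0 + (\<Sum>i=1..m. l i)" for l0 :: real and m :: nat
proof -
  have "{..m} = insert 0 {1..m}" by auto
  then show ?thesis by simp
qed

lemma sum_tail: "k \<le> d \<Longrightarrow> (\<Sum>i=j..d-k. f (k + i)) = (\<Sum>i=j+k..d. f i)" for f :: "nat \<Rightarrow> real"
  using sum.shift_bounds_cl_nat_ivl[of f j k "d - k"] by (simp add: add.commute)

subsection \<open>The simplex with the orthocenter as a vertex\<close>

text \<open>\<open>q J\<close> is the foot of the perpendicular from the origin to the affine hull of \<open>p ` J\<close>. Hence \<open>w\<close> is the
  orthocenter of the full simplex on \<open>p 0, \<dots>, p d\<close>, and \<open>p 0\<close> lies in the affine hull of the smaller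
  one, where it provides the facet normals \<open>p 0 - p j\<close> and \<open>w - p 0\<close>.\<close>

locale vertex_orthocenter_simplex =
  fixes d :: nat and \<tau> :: "nat \<Rightarrow> real" and e :: "nat \<Rightarrow> 'a::euclidean_space"
  assumes tau: "\<And>i. i \<le> d \<Longrightarrow> \<tau> i > 0"
    and ortho: "\<And>i j. i \<le> d \<Longrightarrow> j \<le> d \<Longrightarrow> e i \<bullet> e j = (if i = j then 1 else 0)"
begin

definition p where "p i = e i /\<^sub>R \<tau> i"

definition s where "s J = (\<Sum>i\<in>J. (\<tau> i)\<^sup>2)"

definition q where "q J = (\<Sum>i\<in>J. \<tau> i *\<^sub>R e i) /\<^sub>R s J"

abbreviation "w \<equiv> q {0..d}"

lemma s_pos: "J \<subseteq> {0..d} \<Longrightarrow> J \<noteq> {} \<Longrightarrow> s J > 0"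
  unfolding s_def using tau by (intro sum_pos zero_less_power) (auto intro: finite_subset)

lemma p_p: "i \<le> d \<Longrightarrow> j \<le> d \<Longrightarrow> p i \<bullet> p j = (if i = j then 1 / (\<tau> i)\<^sup>2 else 0)"
  by (simp add: p_def ortho power2_eq_square field_simps)

lemma p_q:
  assumes i: "i \<le> d" and J: "J \<subseteq> {0..d}"
  shows "p i \<bullet> q J = (if i \<in> J then 1 / s J else 0)"
proof -
  have fin: "finite J" using J finite_subset by blast
  have "e i \<bullet> (\<Sum>j\<in>J. \<tau> j *\<^sub>R e j) = (\<Sum>j\<in>J. if j = i then \<tau> i else 0)"
    unfolding inner_sum_right using i J ortho by (intro sum.cong) auto
  also have "\<dots> = (if i \<in> J then \<tau> i else 0)" using fin by simp
  finally show ?thesis using tau[OF i] by (simp add: p_def q_def divide_inverse)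
qed

text \<open>Exhibits the foot as a weighted mean of the points \<open>p i\<close>, the form in which
  its membership in affine hulls is proved.\<close>

lemma q_eq: "J \<subseteq> {0..d} \<Longrightarrow> q J = (\<Sum>i\<in>J. (\<tau> i)\<^sup>2 *\<^sub>R p i) /\<^sub>R s J"
  unfolding q_def p_def using tau
  by (intro arg_cong[of _ _ "\<lambda>x. x /\<^sub>R s J"] sum.cong) (force simp: power2_eq_square)+

lemma q_q:
  assumes "J \<subseteq> J'" "J' \<subseteq> {0..d}" "J \<noteq> {}"
  shows "q J \<bullet> q J' = 1 / s J'"
proof -
  have "(\<Sum>i\<in>J. (\<tau> i)\<^sup>2 *\<^sub>R p i) \<bullet> q J' = (\<Sum>i\<in>J. (\<tau> i)\<^sup>2 / s J')"
    unfolding inner_sum_left using assms by (intro sum.cong) (auto simp: p_q subset_eq)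
  also have "\<dots> = s J / s J'" by (simp add: s_def sum_divide_distrib)
  finally show ?thesis
    using assms s_pos[of J] by (simp add: q_eq[of J] subset_trans[OF assms(1,2)])
qed

lemma q_in_affine_hull_p:
  assumes J: "J \<subseteq> {0..d}" "J \<noteq> {}"
  shows "q J \<in> affine hull (p ` J)"
proof -
  obtain j where j: "j \<in> J" using J by blast
  have "p j + (\<Sum>i\<in>J. ((\<tau> i)\<^sup>2 / s J) *\<^sub>R (p i - p j)) \<in> affine hull (p ` J)"
    using j by (intro affine_hull_add_sum) (auto intro: hull_inc)
  also have "(\<Sum>i\<in>J. ((\<tau> i)\<^sup>2 / s J) *\<^sub>R (p i - p j)) = (\<Sum>i\<in>J. ((\<tau> i)\<^sup>2 / s J) *\<^sub>R p i) - (\<Sum>i\<in>J. (\<tau> i)\<^sup>2 / s J) *\<^sub>R p j"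
    by (simp add: scaleR_diff_right sum_subtractf scaleR_sum_left)
  also have "(\<Sum>i\<in>J. (\<tau> i)\<^sup>2 / s J) = 1"
    using s_pos[OF J] by (simp add: s_def sum_divide_distrib[symmetric])
  also have "p j + ((\<Sum>i\<in>J. ((\<tau> i)\<^sup>2 / s J) *\<^sub>R p i) - 1 *\<^sub>R p j) = q J"
    by (simp add: q_eq[OF J(1)] scaleR_sum_right divide_inverse mult.commute)
  finally show ?thesis .
qed

text \<open>The point \<open>w\<close> is a weighted mean of \<open>q J'\<close> and the
  \<open>p i\<close> with \<open>i \<in> J\<close>. Solving for \<open>q J'\<close> gives an affine
  combination with coefficient \<open>s {0..d} / s J'\<close> at \<open>w\<close> and
  \<open>- ((\<tau> i)\<^sup>2 / s J')\<close> at \<open>p i\<close>. This locates the foot for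
  faces containing \<open>w\<close>.\<close>

lemma q_in_affine_hull_w:
  assumes J: "J \<subset> {0..d}" "J' = {0..d} - J"
  shows "q J' \<in> affine hull (insert w (p ` J))"
proof -
  have J': "J' \<subseteq> {0..d}" "J' \<noteq> {}" using J by auto
  have fin: "finite J" using J finite_subset by blast
  have split: "sum f {0..d} = sum f J' + sum f J" for f :: "nat \<Rightarrow> 'b::comm_monoid_add"
    using J sum.subset_diff[of J "{0..d}" f] by auto
  have "w + (\<Sum>i\<in>J. (- ((\<tau> i)\<^sup>2 / s J')) *\<^sub>R (p i - w)) \<in> affine hull (insert w (p ` J))"
    by (intro affine_hull_add_sum) (auto intro: hull_inc)
  also have "w + (\<Sum>i\<in>J. (- ((\<tau> i)\<^sup>2 / s J')) *\<^sub>R (p i - w)) = (1 + s J / s J') *\<^sub>R w - (\<Sum>i\<in>J. (\<tau> i)\<^sup>2 *\<^sub>R p i) /\<^sub>R s J'"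
    by (simp add: s_def algebra_simps sum_subtractf sum_divide_distrib scaleR_sum_left scaleR_sum_right sum_negf divide_inverse sum_distrib_right)
  also have "1 + s J / s J' = s {0..d} / s J'"
    using s_pos[OF J'] split[of "\<lambda>i. (\<tau> i)\<^sup>2"] by (simp add: s_def add_divide_distrib)
  also have "(s {0..d} / s J') *\<^sub>R w = (\<Sum>i\<in>{0..d}. (\<tau> i)\<^sup>2 *\<^sub>R p i) /\<^sub>R s J'"
    using s_pos[of "{0..d}"] by (simp add: q_eq divide_inverse)
  also have "\<dots> - (\<Sum>i\<in>J. (\<tau> i)\<^sup>2 *\<^sub>R p i) /\<^sub>R s J' = q J'"
    unfolding split by (simp add: q_eq[OF J'(1)] scaleR_add_right)
  finally show ?thesis .
qed

abbreviation "T0 \<equiv> insert w (p ` {1..d})"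

text \<open>The point \<open>p 0\<close> is the foot \<open>q {0}\<close>, whose complementary
  indices are those of the remaining vertices of \<open>S\<close>.\<close>

lemma p0_in_affine_hull: "p 0 \<in> affine hull T0"
proof -
  have "q {0} \<in> affine hull T0" by (rule q_in_affine_hull_w) auto
  then show ?thesis using tau[of 0] by (simp add: q_eq s_def)
qed

lemma q_p: "i \<le> d \<Longrightarrow> J \<subseteq> {0..d} \<Longrightarrow> q J \<bullet> p i = (if i \<in> J then 1 / s J else 0)"
  by (simp add: inner_commute p_q)

lemma q_w: "J \<subseteq> {0..d} \<Longrightarrow> J \<noteq> {} \<Longrightarrow> q J \<bullet> w = 1 / s {0..d}" "J \<subseteq> {0..d} \<Longrightarrow> J \<noteq> {} \<Longrightarrow> w \<bullet> q J = 1 / s {0..d}"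
  by (simp_all add: q_q inner_commute[of w])

lemma q_self: "J \<subseteq> {0..d} \<Longrightarrow> J \<noteq> {} \<Longrightarrow> q J \<bullet> q J = 1 / s J"
  by (simp add: q_q)

text \<open>All \<open>p i\<close> have the same inner product with \<open>w\<close>, which
  therefore cancels against a difference of two of them; as the \<open>p i\<close> are pairwise
  orthogonal, only the term for \<open>i = j\<close> survives.\<close>

lemma facet_normal_inner:
  assumes "i \<in> {1..d}" "j \<in> {1..d}"
  shows "(p i - w) \<bullet> (p 0 - p j) = 0 \<longleftrightarrow> i \<noteq> j"
  using assms tau[of i] by (auto simp: inner_diff_left inner_diff_right p_p p_q q_p)

text \<open>The edges \<open>p i - w\<close> are biorthogonal, up to scaling, to the vectors
  \<open>p 0 - p j\<close>, hence linearly independent.\<close>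

lemma affine_independent_T0: "\<not> affine_dependent T0" "card T0 = d + 1"
proof -
  have ind: "inj_on (\<lambda>i. p i - w) {1..d}" "independent ((\<lambda>i. p i - w) ` {1..d})"
    using biorthogonal_independent[of "{1..d}" "\<lambda>i. p i - w" "\<lambda>j. p 0 - p j"] facet_normal_inner by auto
  have w: "w \<notin> p ` {1..d}"
  proof
    assume "w \<in> p ` {1..d}"
    then obtain i where "i \<in> {1..d}" "p i - w = 0" by auto
    then show False using facet_normal_inner[of i i] by simp
  qed
  have im: "(\<lambda>x. - w + x) ` p ` {1..d} = (\<lambda>i. p i - w) ` {1..d}" by (simp add: image_image)
  show "\<not> affine_dependent T0" unfolding affine_dependent_iff_dependent[OF w] im by (rule ind(2))
  have "inj_on p {1..d}" using ind(1) unfolding inj_on_def by metis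
  then show "card T0 = d + 1" using w by (simp add: card_image)
qed

section \<open>Faces with and without the vertex \<open>w\<close>\<close>

lemma fw_vertices:
  assumes "k \<le> d"
  shows "insert w (p ` {1..k}) \<union> (\<lambda>i. p (k + i)) ` {1..d - k} = T0"
proof -
  have "(\<lambda>i. k + i) ` {1..d - k} = {k+1..d}" using assms by (simp add: image_add_atLeastAtMost)
  then have "p ` {k+1..d} = (\<lambda>i. p (k + i)) ` {1..d - k}" by (metis image_image)
  moreover have "{1..d} = {1..k} \<union> {k+1..d}" using assms by auto
  ultimately show ?thesis by auto
qed

text \<open>The point \<open>p (k + 1)\<close> is already a vertex of the face, so index 1 is free
  for \<open>w\<close>; it is the index that carries the negative parameter.\<close>

lemma fp_vertices:
  assumes "k < d"
  shows "p ` {1..k+1} \<union> (\<lambda>i. if i = 1 then w else p (k + i)) ` {1..d - k} = T0"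
proof -
  have "{1..d - k} = insert 1 {2..d - k}" using assms by auto
  then have "(\<lambda>i. if i = 1 then w else p (k + i)) ` {1..d - k} = insert w ((\<lambda>i. p (k + i)) ` {2..d-k})" by auto
  moreover have "(\<lambda>i. k + i) ` {2..d - k} = {k+2..d}" using assms by (simp add: image_add_atLeastAtMost)
  then have "p ` {k+2..d} = (\<lambda>i. p (k + i)) ` {2..d - k}" by (metis image_image)
  moreover have "{1..d} = {1..k+1} \<union> {k+2..d}" using assms by auto
  ultimately show ?thesis by auto
qed

text \<open>The foot belongs to the complementary index set, which contains 0. Its inner product
  with each complementary \<open>p i\<close> is its own squared norm, and all these points have the
  same inner product with \<open>w\<close>.\<close>

lemma fw_simplex_face:
  assumes k: "k \<le> d"
  shows "simplex_face (insert w (p ` {1..k})) {1..d - k} (\<lambda>i. p (k + i)) (\<lambda>i. p 0 - p (k + i)) (q (insert 0 {k+1..d}))"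
proof (unfold_locales, unfold fw_vertices[OF k])
  define J where "J = insert 0 {k+1..d}"
  have J: "J \<subseteq> {0..d}" "J \<noteq> {}" and mem: "i \<in> J \<longleftrightarrow> i = 0 \<or> k < i \<and> i \<le> d" for i by (auto simp: J_def)
  note rules = inner_diff_left inner_diff_right p_p p_q[OF _ J(1)] p_q[OF _ order_refl] q_p[OF _ J(1)] q_p[OF _ order_refl] q_w[OF J] q_self[OF J]
  show "q (insert 0 {k+1..d}) \<in> affine hull (insert w (p ` {1..k}))"
    using k by (intro q_in_affine_hull_w) auto
  fix j assume j: "j \<in> {1..d - k}"
  then have kj: "k + j \<le> d" using k by auto
  show "(p (k + j) - q (insert 0 {k+1..d})) \<bullet> (b - q (insert 0 {k+1..d})) = 0" if "b \<in> insert w (p ` {1..k})" for b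
    unfolding J_def[symmetric] using that k j kj by (auto simp: rules mem)
  show "p 0 - p (k + j) \<in> direction_space T0"
    using kj j by (intro diff_in_direction_space p0_in_affine_hull hull_inc) auto
  show "(p 0 - p (k + j)) \<bullet> (b - q (insert 0 {k+1..d})) = 0" if "b \<in> insert w (p ` {1..k})" for b
    unfolding J_def[symmetric] using that k j kj by (auto simp: rules mem)
  show "(p 0 - p (k + j)) \<bullet> (p (k + i) - q (insert 0 {k+1..d})) = 0" if "i \<in> {1..d - k}" "i \<noteq> j" for i
    unfolding J_def[symmetric] using that k j kj by (auto simp: rules mem)
  show "(p 0 - p (k + j)) \<bullet> (p (k + j) - q (insert 0 {k+1..d})) < 0"
    unfolding J_def[symmetric] using k j kj tau[of "k + j"] by (auto simp: rules mem)
qed (use affine_independent_T0 in auto)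

text \<open>The foot uses the indices of the face itself. The normal of the facet opposite
  \<open>w\<close> is \<open>w - p 0\<close>, in which \<open>p 0\<close> has the opposite sign to
  that in \<open>p 0 - p (k + j)\<close>; this is the origin of the sign -1 at index 1.\<close>

lemma fp_simplex_face:
  assumes k: "k < d"
  shows "simplex_face (p ` {1..k+1}) {1..d - k} (\<lambda>i. if i = 1 then w else p (k + i))
    (\<lambda>i. if i = 1 then w - p 0 else p 0 - p (k + i)) (q {1..k+1})"
proof (unfold_locales, unfold fp_vertices[OF k])
  define J where "J = {1..k+1}"
  have J: "J \<subseteq> {0..d}" "J \<noteq> {}" and mem: "i \<in> J \<longleftrightarrow> 1 \<le> i \<and> i \<le> k + 1" for i using k by (auto simp: J_def)
  note rules = inner_diff_left inner_diff_right p_p p_q[OF _ J(1)] p_q[OF _ order_refl] q_p[OF _ J(1)] q_p[OF _ order_refl] q_w[OF J] q_self[OF J]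
    q_self[of "{0..d}", OF order_refl]
  show "q {1..k+1} \<in> affine hull (p ` {1..k+1})"
    using k by (intro q_in_affine_hull_p) auto
  have tot: "s {0..d} > 0" by (intro s_pos) auto
  fix j assume j: "j \<in> {1..d - k}"
  then have kj: "k + j \<le> d" using k by auto
  show "((if j = 1 then w else p (k + j)) - q {1..k+1}) \<bullet> (b - q {1..k+1}) = 0" if "b \<in> p ` {1..k+1}" for b
    unfolding J_def[symmetric] using that k j kj by (auto simp: rules mem)
  show "(if j = 1 then w - p 0 else p 0 - p (k + j)) \<in> direction_space T0"
  proof -
    have "w - p 0 \<in> direction_space T0"
      by (intro diff_in_direction_space p0_in_affine_hull hull_inc) auto
    moreover have "p 0 - p (k + j) \<in> direction_space T0"
      using kj j by (intro diff_in_direction_space p0_in_affine_hull hull_inc) auto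
    ultimately show ?thesis by (simp only: split: if_split) simp
  qed
  show "(if j = 1 then w - p 0 else p 0 - p (k + j)) \<bullet> (b - q {1..k+1}) = 0" if "b \<in> p ` {1..k+1}" for b
    unfolding J_def[symmetric] using that k j kj by (auto simp: rules mem)
  show "(if j = 1 then w - p 0 else p 0 - p (k + j)) \<bullet> ((if i = 1 then w else p (k + i)) - q {1..k+1}) = 0" if "i \<in> {1..d - k}" "i \<noteq> j" for i
    unfolding J_def[symmetric] using that k j kj by (auto simp: rules mem)
  show "(if j = 1 then w - p 0 else p 0 - p (k + j)) \<bullet> ((if j = 1 then w else p (k + j)) - q {1..k+1}) < 0"
    unfolding J_def[symmetric] using k j kj tau[of "k + j"] tot by (auto simp: rules mem)
qed (use affine_independent_T0 in auto)

section \<open>Gram matrices and sign conditions on the parameters\<close>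

lemma fw_tangent_gram:
  assumes k: "k \<le> d" and ij: "i \<in> {1..d - k}" "j \<in> {1..d - k}"
  shows "(p (k + i) - q (insert 0 {k+1..d})) \<bullet> (p (k + j) - q (insert 0 {k+1..d})) =
    ortho_cov (- (\<tau> 0)\<^sup>2 - (\<Sum>i=k+1..d. (\<tau> i)\<^sup>2)) (\<lambda>i. (\<tau> (k + i))\<^sup>2) i j"
proof -
  define J where "J = insert 0 {k+1..d}"
  have J: "J \<subseteq> {0..d}" "J \<noteq> {}" and mem: "i \<in> J \<longleftrightarrow> i = 0 \<or> k < i \<and> i \<le> d" for i by (auto simp: J_def)
  have l0: "- (\<tau> 0)\<^sup>2 - (\<Sum>i=k+1..d. (\<tau> i)\<^sup>2) = - s J" by (simp add: s_def J_def)
  show ?thesis unfolding l0 unfolding J_def[symmetric] ortho_cov_def using k ij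
    by (auto simp: inner_diff_left inner_diff_right p_p p_q[OF _ J(1)] q_p[OF _ J(1)] q_self[OF J] mem)
qed

lemma fw_normal_gram:
  assumes k: "k \<le> d" and ij: "i \<in> {1..d - k}" "j \<in> {1..d - k}"
  shows "(p 0 - p (k + i)) \<bullet> (p 0 - p (k + j)) = ortho_cov ((\<tau> 0)\<^sup>2) (\<lambda>i. (\<tau> (k + i))\<^sup>2) i j"
  using k ij by (auto simp: ortho_cov_def inner_diff_left inner_diff_right p_p)

text \<open>Off the diagonal every product is \<open>1 / s {1..k+1}\<close>, the squared norm of the
  foot. On the diagonal \<open>w\<close> contributes a further \<open>- 1 / s {0..d}\<close>, hence
  the negative parameter at index 1.\<close>

lemma fp_tangent_gram:
  assumes k: "k < d" and ij: "i \<in> {1..d - k}" "j \<in> {1..d - k}"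
  shows "((if i = 1 then w else p (k + i)) - q {1..k+1}) \<bullet> ((if j = 1 then w else p (k + j)) - q {1..k+1}) =
    ortho_cov (\<Sum>i=1..k+1. (\<tau> i)\<^sup>2) (\<lambda>i. if i = 1 then - s {0..d} else (\<tau> (k + i))\<^sup>2) i j"
proof -
  define J where "J = {1..k+1}"
  have J: "J \<subseteq> {0..d}" "J \<noteq> {}" and mem: "i \<in> J \<longleftrightarrow> 1 \<le> i \<and> i \<le> k + 1" for i using k by (auto simp: J_def)
  have l0: "(\<Sum>i=1..k+1. (\<tau> i)\<^sup>2) = s J" by (simp add: s_def J_def)
  show ?thesis unfolding l0 unfolding J_def[symmetric] ortho_cov_def using k ij
    by (auto simp: inner_diff_left inner_diff_right p_p p_q[OF _ J(1)] p_q[OF _ order_refl] q_p[OF _ J(1)]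
        q_p[OF _ order_refl] q_w[OF J] q_self[OF J] q_self[of "{0..d}", OF order_refl] mem)
qed

text \<open>Mixed products with \<open>w - p 0\<close> equal
  \<open>- 1 / (\<tau> 0)\<^sup>2\<close>; the sign -1 at index 1 turns them into the required
  \<open>1 / (\<tau> 0)\<^sup>2\<close>.\<close>

lemma fp_normal_gram:
  assumes k: "k < d" and ij: "i \<in> {1..d - k}" "j \<in> {1..d - k}"
  shows "(if i = 1 then -1 else 1) * (if j = 1 then -1 else 1) *
      ((if i = 1 then w - p 0 else p 0 - p (k + i)) \<bullet> (if j = 1 then w - p 0 else p 0 - p (k + j))) =
    ortho_cov ((\<tau> 0)\<^sup>2) (\<lambda>i. if i = 1 then - s {0..d} else (\<tau> (k + i))\<^sup>2) i j"
  using k ij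
  by (auto simp: ortho_cov_def inner_diff_left inner_diff_right p_p p_q[OF _ order_refl] q_p[OF _ order_refl]
      q_self[of "{0..d}", OF order_refl])

text \<open>The negative parameter is at index 0, and all parameters sum to
  \<open>- (\<tau> 0)\<^sup>2\<close>.\<close>

lemma fw_tangent_cond:
  assumes k: "k < d"
  shows "cond_B (d - k) (- (\<tau> 0)\<^sup>2 - (\<Sum>i=k+1..d. (\<tau> i)\<^sup>2)) (\<lambda>i. (\<tau> (k + i))\<^sup>2)"
proof -
  define r where "r = (\<Sum>i=k+1..d. (\<tau> i)\<^sup>2)"
  have "0 \<le> r" unfolding r_def by (intro sum_nonneg) simp
  moreover have tau0: "0 < (\<tau> 0)\<^sup>2" using tau[of 0] by simp
  ultimately have "- (\<tau> 0)\<^sup>2 - r < 0" by linarith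
  moreover have "0 < (\<tau> (k + j))\<^sup>2" if "j \<le> d - k" for j using that k by (intro zero_less_power tau) simp
  moreover have "(\<Sum>i=1..d-k. (\<tau> (k + i))\<^sup>2) = r"
    using sum_tail[of k d "\<lambda>i. (\<tau> i)\<^sup>2" 1] k by (simp add: r_def)
  ultimately show ?thesis
    unfolding cond_B_def sum_upd_zero r_def[symmetric] using tau0
    by (intro conjI exI[of _ 0]) auto
qed

lemma fw_normal_cond:
  assumes k: "k < d"
  shows "cond_A (d - k) ((\<tau> 0)\<^sup>2) (\<lambda>i. (\<tau> (k + i))\<^sup>2)"
proof -
  have "0 < (\<tau> 0)\<^sup>2" using tau[of 0] by simp
  moreover have "0 < (\<tau> (k + j))\<^sup>2" if "j \<le> d - k" for j using that k by (intro zero_less_power tau) simp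
  ultimately show ?thesis by (simp add: cond_A_def)
qed

text \<open>Shared by the tangent and the normal cone, which differ only in \<open>l0\<close>. The
  negative parameter is at index 1, and the upper bound involving \<open>l0\<close> says that the
  parameters have a negative sum.\<close>

lemma fp_cond:
  assumes k: "k < d" and l0: "0 < l0" "l0 + (\<Sum>i=k+2..d. (\<tau> i)\<^sup>2) < s {0..d}"
  shows "cond_B (d - k) l0 (\<lambda>i. if i = 1 then - s {0..d} else (\<tau> (k + i))\<^sup>2)"
proof -
  let ?l = "\<lambda>i. if i = 1 then - s {0..d} else (\<tau> (k + i))\<^sup>2"
  have tot: "s {0..d} > 0" by (intro s_pos) auto
  have "{1..d-k} = insert 1 {2..d-k}" using k by auto
  then have "(\<Sum>i=1..d-k. ?l i) = - s {0..d} + (\<Sum>i=2..d-k. ?l i)" by simp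
  also have "(\<Sum>i=2..d-k. ?l i) = (\<Sum>i=2..d-k. (\<tau> (k + i))\<^sup>2)" by (intro sum.cong) auto
  also have "\<dots> = (\<Sum>i=k+2..d. (\<tau> i)\<^sup>2)" using sum_tail[of k d "\<lambda>i. (\<tau> i)\<^sup>2" 2] k by (simp add: add.commute)
  finally have "(\<Sum>i\<le>d-k. (?l(0 := l0)) i) < 0" unfolding sum_upd_zero using l0 by simp
  moreover have "0 < (\<tau> (k + j))\<^sup>2" if "j \<le> d - k" for j using that k by (intro zero_less_power tau) simp
  ultimately show ?thesis unfolding cond_B_def using k tot l0(1)
    by (intro conjI exI[of _ 1]) auto
qed

lemma s_split:
  assumes k: "k < d"
  shows "s {0..d} = (\<tau> 0)\<^sup>2 + ((\<Sum>i=1..k+1. (\<tau> i)\<^sup>2) + (\<Sum>i=k+2..d. (\<tau> i)\<^sup>2))"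
proof -
  have "{0..d} = insert 0 ({1..k+1} \<union> {k+2..d})" using k by auto
  then show ?thesis
    unfolding s_def by (simp only:) (subst sum.insert; simp add: sum.union_disjoint)
qed

lemma fp_tangent_cond:
  assumes k: "k < d"
  shows "cond_B (d - k) (\<Sum>i=1..k+1. (\<tau> i)\<^sup>2) (\<lambda>i. if i = 1 then - s {0..d} else (\<tau> (k + i))\<^sup>2)"
proof (rule fp_cond[OF k])
  show "0 < (\<Sum>i=1..k+1. (\<tau> i)\<^sup>2)"
    using s_pos[of "{1..k+1}"] k by (simp add: s_def)
  show "(\<Sum>i=1..k+1. (\<tau> i)\<^sup>2) + (\<Sum>i=k+2..d. (\<tau> i)\<^sup>2) < s {0..d}"
    using s_split[OF k] tau[of 0] by simp
qed

text \<open>Here the parameters sum to minus the squares over the indices of the face; for the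
  tangent cone the sum is \<open>- (\<tau> 0)\<^sup>2\<close>.\<close>

lemma fp_normal_cond:
  assumes k: "k < d"
  shows "cond_B (d - k) ((\<tau> 0)\<^sup>2) (\<lambda>i. if i = 1 then - s {0..d} else (\<tau> (k + i))\<^sup>2)"
proof (rule fp_cond[OF k])
  show "0 < (\<tau> 0)\<^sup>2" using tau[of 0] by simp
  have "0 < (\<Sum>i=1..k+1. (\<tau> i)\<^sup>2)"
    using s_pos[of "{1..k+1}"] k by (simp add: s_def)
  then show "(\<tau> 0)\<^sup>2 + (\<Sum>i=k+2..d. (\<tau> i)\<^sup>2) < s {0..d}" by (simp add: s_split[OF k])
qed

section \<open>Cones and angles of the simplex\<close>

abbreviation "S \<equiv> convex hull T0"
abbreviation "Fp k \<equiv> convex hull (p ` {1..k+1})"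
abbreviation "Fw k \<equiv> convex hull (insert w (p ` {1..k}))"

lemma simplex_S: "int d simplex S"
  unfolding simplex_def using affine_independent_T0 by (intro exI[of _ T0]) auto

text \<open>For \<open>k = d\<close> the simplex is its own face and the index set
  \<open>{1..d - d}\<close> is empty: no halfspace restricts the tangent cone, and the positive hull
  of no normals is \<open>{0}\<close>.\<close>

lemma tangent_normal_self:
  "tangent_cone (direction_space S) S S = direction_space S" "normal_cone (direction_space S) S S = {0}"
proof -
  interpret F: simplex_face "insert w (p ` {1..d})" "{1..d - d}" "\<lambda>i. p (d + i)" "\<lambda>i. p 0 - p (d + i)" "q (insert 0 {d+1..d})"
    by (rule fw_simplex_face) simp
  show "tangent_cone (direction_space S) S S = direction_space S"
    using F.tangent_cone_halfspaces unfolding fw_vertices[OF order_refl] by simp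
  show "normal_cone (direction_space S) S S = {0}"
    using F.normal_cone_eq_hull unfolding fw_vertices[OF order_refl] by simp
qed

lemma fp_cones:
  assumes k: "k < d"
  shows "\<exists>C. tangent_cone (direction_space S) (Fp k) S = {x + y | x y. x \<in> direction_space (Fp k) \<and> y \<in> C} \<and>
           (\<forall>x\<in>direction_space (Fp k). \<forall>y\<in>C. orthogonal x y) \<and>
           isometric_to_orthocentric_cone C (d - k) (\<Sum>i=1..k+1. (\<tau> i)\<^sup>2)
             (\<lambda>i. if i = 1 then - s {0..d} else (\<tau> (k + i))\<^sup>2) (\<lambda>i. 1)"
    and "isometric_to_orthocentric_cone (normal_cone (direction_space S) (Fp k) S) (d - k) ((\<tau> 0)\<^sup>2)
        (\<lambda>i. if i = 1 then - s {0..d} else (\<tau> (k + i))\<^sup>2) (\<lambda>i. if i = 1 then -1 else 1)"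
    and "internal_angle (direction_space S) (Fp k) S =
        gauss_orthant (d - k) ((\<tau> 0)\<^sup>2)
          (\<lambda>i. if i = 1 then - s {0..d} else (\<tau> (k + i))\<^sup>2) (\<lambda>i. if i = 1 then -1 else 1)"
    and "external_angle (direction_space S) (Fp k) S =
        gauss_orthant (d - k) (\<Sum>i=1..k+1. (\<tau> i)\<^sup>2)
          (\<lambda>i. if i = 1 then - s {0..d} else (\<tau> (k + i))\<^sup>2) (\<lambda>i. 1)"
proof -
  interpret F: simplex_face "p ` {1..k+1}" "{1..d - k}" "\<lambda>i. if i = 1 then w else p (k + i)"
      "\<lambda>i. if i = 1 then w - p 0 else p 0 - p (k + i)" "q {1..k+1}"
    by (rule fp_simplex_face[OF k])
  note V = direction_space_convex_hull fp_vertices[OF k, symmetric]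
  have m: "1 \<le> d - k" using k by simp
  show "\<exists>C. tangent_cone (direction_space S) (Fp k) S = {x + y | x y. x \<in> direction_space (Fp k) \<and> y \<in> C} \<and>
           (\<forall>x\<in>direction_space (Fp k). \<forall>y\<in>C. orthogonal x y) \<and>
           isometric_to_orthocentric_cone C (d - k) (\<Sum>i=1..k+1. (\<tau> i)\<^sup>2)
             (\<lambda>i. if i = 1 then - s {0..d} else (\<tau> (k + i))\<^sup>2) (\<lambda>i. 1)"
    unfolding V
    by (rule F.tangent_cone_orthocentric[OF refl m disjI2[OF fp_tangent_cond[OF k]] fp_tangent_gram[OF k]])
  show "isometric_to_orthocentric_cone (normal_cone (direction_space S) (Fp k) S) (d - k) ((\<tau> 0)\<^sup>2)
        (\<lambda>i. if i = 1 then - s {0..d} else (\<tau> (k + i))\<^sup>2) (\<lambda>i. if i = 1 then -1 else 1)"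
    unfolding V
    by (rule F.normal_cone_orthocentric[OF refl m disjI2[OF fp_normal_cond[OF k]] _ fp_normal_gram[OF k]]) simp
  show "internal_angle (direction_space S) (Fp k) S =
        gauss_orthant (d - k) ((\<tau> 0)\<^sup>2)
          (\<lambda>i. if i = 1 then - s {0..d} else (\<tau> (k + i))\<^sup>2) (\<lambda>i. if i = 1 then -1 else 1)"
    unfolding V
    by (rule F.internal_angle_eq_gauss_orthant[OF refl _ fp_normal_gram[OF k]]) simp
  show "external_angle (direction_space S) (Fp k) S =
        gauss_orthant (d - k) (\<Sum>i=1..k+1. (\<tau> i)\<^sup>2)
          (\<lambda>i. if i = 1 then - s {0..d} else (\<tau> (k + i))\<^sup>2) (\<lambda>i. 1)"
    unfolding V
    by (rule F.external_angle_eq_gauss_orthant[OF refl fp_tangent_gram[OF k]])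
qed

lemma fw_cones:
  assumes k: "k < d"
  shows "\<exists>C. tangent_cone (direction_space S) (Fw k) S = {x + y | x y. x \<in> direction_space (Fw k) \<and> y \<in> C} \<and>
           (\<forall>x\<in>direction_space (Fw k). \<forall>y\<in>C. orthogonal x y) \<and>
           isometric_to_orthocentric_cone C (d - k) (- (\<tau> 0)\<^sup>2 - (\<Sum>i=k+1..d. (\<tau> i)\<^sup>2))
             (\<lambda>i. (\<tau> (k + i))\<^sup>2) (\<lambda>i. 1)"
    and "isometric_to_orthocentric_cone (normal_cone (direction_space S) (Fw k) S) (d - k) ((\<tau> 0)\<^sup>2)
        (\<lambda>i. (\<tau> (k + i))\<^sup>2) (\<lambda>i. 1)"
proof -
  have k': "k \<le> d" using k by simp
  interpret F: simplex_face "insert w (p ` {1..k})" "{1..d - k}" "\<lambda>i. p (k + i)" "\<lambda>i. p 0 - p (k + i)"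
      "q (insert 0 {k+1..d})"
    by (rule fw_simplex_face[OF k'])
  note V = direction_space_convex_hull
  have m: "1 \<le> d - k" using k by simp
  show "\<exists>C. tangent_cone (direction_space S) (Fw k) S = {x + y | x y. x \<in> direction_space (Fw k) \<and> y \<in> C} \<and>
           (\<forall>x\<in>direction_space (Fw k). \<forall>y\<in>C. orthogonal x y) \<and>
           isometric_to_orthocentric_cone C (d - k) (- (\<tau> 0)\<^sup>2 - (\<Sum>i=k+1..d. (\<tau> i)\<^sup>2))
             (\<lambda>i. (\<tau> (k + i))\<^sup>2) (\<lambda>i. 1)"
    using F.tangent_cone_orthocentric[OF refl m disjI2[OF fw_tangent_cond[OF k]] fw_tangent_gram[OF k']]
    unfolding V fw_vertices[OF k'] .
  show "isometric_to_orthocentric_cone (normal_cone (direction_space S) (Fw k) S) (d - k) ((\<tau> 0)\<^sup>2)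
        (\<lambda>i. (\<tau> (k + i))\<^sup>2) (\<lambda>i. 1)"
    using F.normal_cone_orthocentric[OF refl m disjI1[OF fw_normal_cond[OF k]], of "\<lambda>i. 1"] fw_normal_gram[OF k']
    unfolding V fw_vertices[OF k'] by simp
qed

lemma fw_angles:
  assumes k: "k \<le> d"
  shows "internal_angle (direction_space S) (Fw k) S =
        gauss_orthant (d - k) ((\<tau> 0)\<^sup>2) (\<lambda>i. (\<tau> (k + i))\<^sup>2) (\<lambda>i. 1)"
    and "external_angle (direction_space S) (Fw k) S =
        gauss_orthant (d - k) (- (\<tau> 0)\<^sup>2 - (\<Sum>i=k+1..d. (\<tau> i)\<^sup>2)) (\<lambda>i. (\<tau> (k + i))\<^sup>2) (\<lambda>i. 1)"
proof -
  interpret F: simplex_face "insert w (p ` {1..k})" "{1..d - k}" "\<lambda>i. p (k + i)" "\<lambda>i. p 0 - p (k + i)"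
      "q (insert 0 {k+1..d})"
    by (rule fw_simplex_face[OF k])
  show "internal_angle (direction_space S) (Fw k) S =
        gauss_orthant (d - k) ((\<tau> 0)\<^sup>2) (\<lambda>i. (\<tau> (k + i))\<^sup>2) (\<lambda>i. 1)"
    using F.internal_angle_eq_gauss_orthant[OF refl, of "\<lambda>i. 1"] fw_normal_gram[OF k]
    unfolding direction_space_convex_hull fw_vertices[OF k] by simp
  show "external_angle (direction_space S) (Fw k) S =
        gauss_orthant (d - k) (- (\<tau> 0)\<^sup>2 - (\<Sum>i=k+1..d. (\<tau> i)\<^sup>2)) (\<lambda>i. (\<tau> (k + i))\<^sup>2) (\<lambda>i. 1)"
    using F.external_angle_eq_gauss_orthant[OF refl fw_tangent_gram[OF k]]
    unfolding direction_space_convex_hull fw_vertices[OF k] .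
qed

end

theorem theorem5p6:
  fixes d :: nat and \<tau> :: "nat \<Rightarrow> real" and e :: "nat \<Rightarrow> 'a::euclidean_space"
    and w :: 'a and p :: "nat \<Rightarrow> 'a" and S V :: "'a set"
    and Fp Fw :: "nat \<Rightarrow> 'a set" and tot :: real
  assumes d: "d \<ge> 2"
    and tau: "\<And>i. i \<le> d \<Longrightarrow> \<tau> i > 0"
    and dim: "DIM('a) = d + 1"
    and basis: "bij_betw e {0..d} Basis"
    and tot: "tot = (\<Sum>i=0..d. (\<tau> i)\<^sup>2)"
    and w: "w = (\<Sum>i=0..d. \<tau> i *\<^sub>R e i) /\<^sub>R tot"
    and p: "\<And>i. p i = e i /\<^sub>R \<tau> i"
    and S: "S = convex hull (insert w (p ` {1..d}))"
    and V: "V = direction_space S"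
    and Fp: "\<And>k. Fp k = convex hull (p ` {1..k+1})"
    and Fw: "\<And>k. Fw k = convex hull (insert w (p ` {1..k}))"
  shows
   "int d simplex S \<and>
    \<comment> \<open>(a)\<close>
    (tangent_cone V S S = V \<and> normal_cone V S S = {0}) \<and>
    \<comment> \<open>(b)\<close>
    (\<forall>k\<in>{0..d-1}.
      (\<exists>C. tangent_cone V (Fp k) S = {x + y | x y. x \<in> direction_space (Fp k) \<and> y \<in> C} \<and>
           (\<forall>x\<in>direction_space (Fp k). \<forall>y\<in>C. orthogonal x y) \<and>
           isometric_to_orthocentric_cone C (d - k) (\<Sum>i=1..k+1. (\<tau> i)\<^sup>2)
             (\<lambda>i. if i = 1 then - tot else (\<tau> (k + i))\<^sup>2) (\<lambda>i. 1)) \<and>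
      isometric_to_orthocentric_cone (normal_cone V (Fp k) S) (d - k) ((\<tau> 0)\<^sup>2)
        (\<lambda>i. if i = 1 then - tot else (\<tau> (k + i))\<^sup>2) (\<lambda>i. if i = 1 then -1 else 1)) \<and>
    \<comment> \<open>(c)\<close>
    (\<forall>k\<in>{0..d-1}.
      (\<exists>C. tangent_cone V (Fw k) S = {x + y | x y. x \<in> direction_space (Fw k) \<and> y \<in> C} \<and>
           (\<forall>x\<in>direction_space (Fw k). \<forall>y\<in>C. orthogonal x y) \<and>
           isometric_to_orthocentric_cone C (d - k) (- (\<tau> 0)\<^sup>2 - (\<Sum>i=k+1..d. (\<tau> i)\<^sup>2))
             (\<lambda>i. (\<tau> (k + i))\<^sup>2) (\<lambda>i. 1)) \<and>
      isometric_to_orthocentric_cone (normal_cone V (Fw k) S) (d - k) ((\<tau> 0)\<^sup>2)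
        (\<lambda>i. (\<tau> (k + i))\<^sup>2) (\<lambda>i. 1)) \<and>
    \<comment> \<open>(d)\<close>
    (\<forall>k\<in>{0..d-1}.
      internal_angle V (Fp k) S =
        gauss_orthant (d - k) ((\<tau> 0)\<^sup>2)
          (\<lambda>i. if i = 1 then - tot else (\<tau> (k + i))\<^sup>2) (\<lambda>i. if i = 1 then -1 else 1) \<and>
      external_angle V (Fp k) S =
        gauss_orthant (d - k) (\<Sum>i=1..k+1. (\<tau> i)\<^sup>2)
          (\<lambda>i. if i = 1 then - tot else (\<tau> (k + i))\<^sup>2) (\<lambda>i. 1)) \<and>
    (\<forall>k\<in>{0..d}.
      internal_angle V (Fw k) S =
        gauss_orthant (d - k) ((\<tau> 0)\<^sup>2) (\<lambda>i. (\<tau> (k + i))\<^sup>2) (\<lambda>i. 1) \<and>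
      external_angle V (Fw k) S =
        gauss_orthant (d - k) (- (\<tau> 0)\<^sup>2 - (\<Sum>i=k+1..d. (\<tau> i)\<^sup>2))
          (\<lambda>i. (\<tau> (k + i))\<^sup>2) (\<lambda>i. 1))"
proof -
  interpret Q: vertex_orthocenter_simplex d \<tau> e
  proof
    fix i j assume ij: "i \<le> d" "j \<le> d"
    have "e i \<in> Basis" "e j \<in> Basis" using basis ij by (auto simp: bij_betw_def)
    moreover have "e i = e j \<longleftrightarrow> i = j"
      using basis ij by (auto simp: bij_betw_def dest: inj_onD)
    ultimately show "e i \<bullet> e j = (if i = j then 1 else 0)" by (simp add: inner_Basis)
  qed (rule tau)
  have p_eq: "p = Q.p" by (simp add: fun_eq_iff p Q.p_def)
  have tot_eq: "tot = Q.s {0..d}" by (simp add: tot Q.s_def)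
  have w_eq: "w = Q.q {0..d}" by (simp add: w Q.q_def tot_eq)
  \<comment> \<open>Subtraction is on the naturals, so \<open>k \<le> d - 1\<close> gives
    \<open>k < d\<close> by way of \<open>d > 0\<close>.\<close>
  have lt: "k < d" if "k \<in> {0..d-1}" for k using that d by auto
  show ?thesis
    unfolding V S Fp Fw p_eq w_eq tot_eq
    using Q.simplex_S Q.tangent_normal_self Q.fp_cones[OF lt] Q.fw_cones[OF lt] Q.fw_angles
    by (intro conjI ballI) (simp_all only: atLeastAtMost_iff)
qed

end
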